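(* Let $Y$ be a smooth fence with a strongly compatible order $\preceq$. Then there exists a fine projective sequence $(P_n,\varphi_n^m)$ of structures from $\mathcal F_0$ such that, denoting by $\mathbb P$ its projective limit, by $\varphi_n:\mathbb P\to P_n$ the projections and by $p:\mathbb P\to\mathbb P/R^{\mathbb P}$ the quotient map: (a) $p$ is irreducible; (b) there is a homeomorphism $g:\mathbb P/R^{\mathbb P}\to Y$ which is also an order isomorphism between $\le^{\mathbb P/R^{\mathbb P}}$ and $\preceq$; (c) for each $n\in\mathbb N$ and $a,a'\in P_n$, $a\le^{P_n}a'$ holds if and only if there are $x\in\operatorname{int}(p[\varphi_n^{-1}(a)])$ and $x'\in\operatorname{int}(p[\varphi_n^{-1}(a')])$ with $g(x)\preceq g(x')$.
   Context: Let $\mathcal L_R=\{R,\le\}$. A finite Hasse linear order (HLO) is a finite (discrete) $\mathcal L_R$-structure in which $\le$ is a total order and $a\,R\,b$ iff $a=b$ or one of $a,b$ is the immediate $\le$-successor of the other. $\mathcal F_0$ is the family of finite disjoint unions of finite HLOs. An epimorphism $\varphi:A\to B$ is a continuous surjection with $r^B=(\varphi\times\varphi)[r^A]$ for $r\in\{R,\le\}$. A projective sequence $(P_n,\varphi_n^m)$ consists of structures $P_n$, epimorphisms $\varphi_n^{n+1}:P_{n+1}\to P_n$ and their compositions $\varphi_n^m$; its projective limit is $\mathbb P=\{u\in\prod_nP_n:u(n)=\varphi_n^{n+1}(u(n+1))\ \forall n\}$ with product topology, $r^{\mathbb P}(u,v)$ iff $r^{P_n}(u(n),v(n))$ for all $n$,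 and $\varphi_n(u)=u(n)$. The sequence is fine if $R^{\mathbb P}$ is an equivalence relation. $\le^{\mathbb P/R^{\mathbb P}}=(p\times p)[\le^{\mathbb P}]$. A continuous map $f:X\to Z$ is irreducible if $f[K]\ne Z$ for every proper closed $K\subsetneq X$. A fence is a compact metrizable space whose connected components are points or arcs; it is smooth if it admits a closed partial order whose restriction to each connected component is total. A strongly compatible order on a fence is a closed partial order whose restriction to each connected component is total and such that two points are comparable iff they lie in the same connected component. *)

theory Defs
  imports "HOL-Analysis.Analysis"
begin

record 'a lr_struct =
  lr_top :: "'a topology"
  lr_R :: "('a \<times> 'a) set"
  lr_le :: "('a \<times> 'a) set"

abbreviation lr_carrier :: "'a lr_struct \<Rightarrow> 'a set"
  where "lr_carrier A \<equiv> topspace (lr_top A)"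

definition immediate_succ :: "('a \<times> 'a) set \<Rightarrow> 'a \<Rightarrow> 'a \<Rightarrow> bool"
  where "immediate_succ r a b \<longleftrightarrow>
    (a, b) \<in> r \<and> a \<noteq> b \<and> \<not> (\<exists>c. c \<noteq> a \<and> c \<noteq> b \<and> (a, c) \<in> r \<and> (c, b) \<in> r)"

text \<open>The empty structure is allowed as a finite HLO; in a disjoint union it has no effect.\<close>

definition finite_HLO :: "'a lr_struct \<Rightarrow> bool"
  where "finite_HLO A \<longleftrightarrow>
    finite (lr_carrier A) \<and>
    lr_top A = discrete_topology (lr_carrier A) \<and>
    linear_order_on (lr_carrier A) (lr_le A) \<and>
    lr_R A = {(a, b). a \<in> lr_carrier A \<and> b \<in> lr_carrier A \<and>
      (a = b \<or> immediate_succ (lr_le A) a b \<or> immediate_succ (lr_le A) b a)}"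

definition F0 :: "'a lr_struct set"
  where "F0 = {A. \<exists>\<H>. finite \<H> \<and> (\<forall>H\<in>\<H>. finite_HLO H) \<and>
    pairwise (\<lambda>H H'. disjnt (lr_carrier H) (lr_carrier H')) \<H> \<and>
    lr_top A = discrete_topology (\<Union>H\<in>\<H>. lr_carrier H) \<and>
    lr_R A = (\<Union>H\<in>\<H>. lr_R H) \<and>
    lr_le A = (\<Union>H\<in>\<H>. lr_le H)}"

definition epimorphism :: "'a lr_struct \<Rightarrow> 'b lr_struct \<Rightarrow> ('a \<Rightarrow> 'b) \<Rightarrow> bool"
  where "epimorphism A B \<phi> \<longleftrightarrow>
    continuous_map (lr_top A) (lr_top B) \<phi> \<and>
    \<phi> ` lr_carrier A = lr_carrier B \<and>
    lr_R B = map_prod \<phi> \<phi> ` lr_R A \<and>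
    lr_le B = map_prod \<phi> \<phi> ` lr_le A"

text \<open>\<open>\<phi> n m\<close> is the bonding map from \<open>P m\<close> to \<open>P n\<close>; only its values on the carrier of \<open>P m\<close>
  for \<open>n \<le> m\<close> matter.\<close>

definition projective_sequence :: "(nat \<Rightarrow> 'a lr_struct) \<Rightarrow> (nat \<Rightarrow> nat \<Rightarrow> 'a \<Rightarrow> 'a) \<Rightarrow> bool"
  where "projective_sequence P \<phi> \<longleftrightarrow>
    (\<forall>n. epimorphism (P (Suc n)) (P n) (\<phi> n (Suc n))) \<and>
    (\<forall>n. \<forall>x\<in>lr_carrier (P n). \<phi> n n x = x) \<and>
    (\<forall>n m. n \<le> m \<longrightarrow>
      (\<forall>x\<in>lr_carrier (P (Suc m)). \<phi> n (Suc m) x = \<phi> n m (\<phi> m (Suc m) x)))"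

definition limit_points ::
  "(nat \<Rightarrow> 'a lr_struct) \<Rightarrow> (nat \<Rightarrow> nat \<Rightarrow> 'a \<Rightarrow> 'a) \<Rightarrow> (nat \<Rightarrow> 'a) set"
  where "limit_points P \<phi> =
    {u \<in> (\<Pi>\<^sub>E n\<in>UNIV. lr_carrier (P n)). \<forall>n. u n = \<phi> n (Suc n) (u (Suc n))}"

definition projective_limit ::
  "(nat \<Rightarrow> 'a lr_struct) \<Rightarrow> (nat \<Rightarrow> nat \<Rightarrow> 'a \<Rightarrow> 'a) \<Rightarrow> (nat \<Rightarrow> 'a) lr_struct"
  where "projective_limit P \<phi> =
    \<lparr>lr_top = subtopology (product_topology (\<lambda>n. lr_top (P n)) UNIV) (limit_points P \<phi>),
     lr_R = {(u, v). u \<in> limit_points P \<phi> \<and> v \<in> limit_points P \<phi> \<and>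
               (\<forall>n. (u n, v n) \<in> lr_R (P n))},
     lr_le = {(u, v). u \<in> limit_points P \<phi> \<and> v \<in> limit_points P \<phi> \<and>
               (\<forall>n. (u n, v n) \<in> lr_le (P n))}\<rparr>"

lemma lr_carrier_projective_limit: "lr_carrier (projective_limit P \<phi>) = limit_points P \<phi>"
  by (auto simp: projective_limit_def limit_points_def)

definition fine_projective_sequence ::
  "(nat \<Rightarrow> 'a lr_struct) \<Rightarrow> (nat \<Rightarrow> nat \<Rightarrow> 'a \<Rightarrow> 'a) \<Rightarrow> bool"
  where "fine_projective_sequence P \<phi> \<longleftrightarrow>
    projective_sequence P \<phi> \<and>
    equiv (lr_carrier (projective_limit P \<phi>)) (lr_R (projective_limit P \<phi>))"

definition quotient_topology :: "'a topology \<Rightarrow> ('a \<Rightarrow> 'b) \<Rightarrow> 'b topology"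
  where "quotient_topology X f =
    topology (\<lambda>U. U \<subseteq> f ` topspace X \<and> openin X {x \<in> topspace X. f x \<in> U})"

lemma openin_quotient_topology:
  "openin (quotient_topology X f) U \<longleftrightarrow>
     U \<subseteq> f ` topspace X \<and> openin X {x \<in> topspace X. f x \<in> U}"
proof -
  have "istopology (\<lambda>U. U \<subseteq> f ` topspace X \<and> openin X {x \<in> topspace X. f x \<in> U})"
    unfolding istopology_def
  proof (intro conjI allI impI)
    fix S T
    assume "S \<subseteq> f ` topspace X \<and> openin X {x \<in> topspace X. f x \<in> S}"
      and "T \<subseteq> f ` topspace X \<and> openin X {x \<in> topspace X. f x \<in> T}"
    moreover have "{x \<in> topspace X. f x \<in> S \<inter> T} =
        {x \<in> topspace X. f x \<in> S} \<inter> {x \<in> topspace X. f x \<in> T}"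
      by auto
    ultimately show "S \<inter> T \<subseteq> f ` topspace X" "openin X {x \<in> topspace X. f x \<in> S \<inter> T}"
      by auto
  next
    fix \<K>
    assume *: "\<forall>K\<in>\<K>. K \<subseteq> f ` topspace X \<and> openin X {x \<in> topspace X. f x \<in> K}"
    then show "\<Union>\<K> \<subseteq> f ` topspace X" by blast
    have "{x \<in> topspace X. f x \<in> \<Union>\<K>} = (\<Union>K\<in>\<K>. {x \<in> topspace X. f x \<in> K})"
      by auto
    with * show "openin X {x \<in> topspace X. f x \<in> \<Union>\<K>}"
      by auto
  qed
  then show ?thesis
    by (simp add: quotient_topology_def)
qed

lemma topspace_quotient_topology: "topspace (quotient_topology X f) = f ` topspace X"
proof -
  have "{x \<in> topspace X. f x \<in> f ` topspace X} = topspace X"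
    by auto
  then have "openin (quotient_topology X f) (f ` topspace X)"
    by (simp add: openin_quotient_topology)
  then show ?thesis
    by (meson openin_quotient_topology openin_subset openin_topspace subset_antisym)
qed

lemma quotient_map_quotient_topology: "quotient_map X (quotient_topology X f) f"
  by (auto simp: quotient_map_def openin_quotient_topology topspace_quotient_topology)

definition R_class :: "'a lr_struct \<Rightarrow> 'a \<Rightarrow> 'a set"
  where "R_class A u = lr_R A `` {u}"

definition R_quotient :: "'a lr_struct \<Rightarrow> 'a set topology"
  where "R_quotient A = quotient_topology (lr_top A) (R_class A)"

lemma topspace_R_quotient: "topspace (R_quotient A) = lr_carrier A // lr_R A"
  by (auto simp: R_quotient_def topspace_quotient_topology R_class_def quotient_def)

definition R_quotient_le :: "'a lr_struct \<Rightarrow> ('a set \<times> 'a set) set"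
  where "R_quotient_le A = map_prod (R_class A) (R_class A) ` lr_le A"

definition irreducible_map :: "'a topology \<Rightarrow> 'b topology \<Rightarrow> ('a \<Rightarrow> 'b) \<Rightarrow> bool"
  where "irreducible_map X Z f \<longleftrightarrow>
    continuous_map X Z f \<and>
    (\<forall>K. closedin X K \<and> K \<subset> topspace X \<longrightarrow> f ` K \<noteq> topspace Z)"

definition is_arc :: "'a topology \<Rightarrow> 'a set \<Rightarrow> bool"
  where "is_arc Y C \<longleftrightarrow> subtopology Y C homeomorphic_space top_of_set {0..1::real}"

definition fence :: "'a topology \<Rightarrow> bool"
  where "fence Y \<longleftrightarrow>
    compact_space Y \<and> metrizable_space Y \<and>
    (\<forall>C\<in>connected_components_of Y. (\<exists>x. C = {x}) \<or> is_arc Y C)"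

definition closed_partial_order :: "'a topology \<Rightarrow> ('a \<times> 'a) set \<Rightarrow> bool"
  where "closed_partial_order Y r \<longleftrightarrow>
    partial_order_on (topspace Y) r \<and> closedin (prod_topology Y Y) r"

definition smooth_fence :: "'a topology \<Rightarrow> bool"
  where "smooth_fence Y \<longleftrightarrow>
    fence Y \<and>
    (\<exists>r. closed_partial_order Y r \<and> (\<forall>C\<in>connected_components_of Y. total_on C r))"

definition strongly_compatible_order :: "'a topology \<Rightarrow> ('a \<times> 'a) set \<Rightarrow> bool"
  where "strongly_compatible_order Y r \<longleftrightarrow>
    closed_partial_order Y r \<and>
    (\<forall>C\<in>connected_components_of Y. total_on C r) \<and>
    (\<forall>x\<in>topspace Y. \<forall>y\<in>topspace Y.
      (x, y) \<in> r \<or> (y, x) \<in> r \<longleftrightarrow> (\<exists>C\<in>connected_components_of Y. x \<in> C \<and> y \<in> C))"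

end

theory Submission
  imports Defs
begin

text \<open>
  A height function \<open>h\<close> on \<open>Y\<close>, continuous and strictly increasing along the order, turns each
  component into an interval of reals. Cutting clopen sets along the dyadic levels of \<open>h\<close> yields
  finer and finer covers of \<open>Y\<close> by closed cells, and \<open>P n\<close> is the \<open>n\<close>-th cover, with \<open>R\<close> read as
  ``the cells meet'' and \<open>\<le>\<close> read off the interiors of the cells. The cells over a clopen set form a
  Hasse linear order as soon as one component in it traverses all of them. For an arbitrary \<open>h\<close> this
  can fail, when components end exactly at a cutting level. By a Baire category argument \<open>h\<close> can be
  chosen such that in every clopen set, if a component touches two rational levels then some
  component crosses both of them strictly; this also makes the cells regular closed. Compactness
  then gives, at each scale, a finite clopen partition each of whose members contains a component
  meeting every slab that the member meets.
\<close>

section \<open>Projective limits of systems of regular closed cells\<close>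


text \<open>Domination of a block by one component and genericity of the height have to work
  together. A dominating component may meet a slab only in a boundary point, and then two nonempty
  cells over one block could have unrelated interiors; genericity replaces it by a component,
  possibly another one, that enters both interiors. Genericity can be had because touching two
  levels is a closed condition on the height and crossing them an open one: the implication from
  \<open>touched\<close> to \<open>crossed\<close> is then open, and arbitrarily small changes of
  the height make it true. A compact metrizable space has only countably many clopen sets, so
  rational levels leave countably many such conditions.

  Cells overlap in their boundaries, so a point may lie on several threads. This is what
  \<open>R\<close> identifies in the limit. It is also the reason why the order is read off
  interiors and why comparable points are lifted to the limit along one monotone choice of threads,
  given by rounding down the rescaled height.\<close>

definition cell_R :: "'i set \<Rightarrow> ('i \<Rightarrow> 'a set) \<Rightarrow> ('i \<times> 'i) set"
  where "cell_R A c = {(a, b). a \<in> A \<and> b \<in> A \<and> c a \<inter> c b \<noteq> {}}"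

text \<open>Interiors, because adjacent cells share boundary points, and a reflexive
  \<open>ord\<close> would relate the full cells in both directions.\<close>

definition cell_le :: "'a topology \<Rightarrow> ('a \<times> 'a) set \<Rightarrow> 'i set \<Rightarrow> ('i \<Rightarrow> 'a set) \<Rightarrow> ('i \<times> 'i) set"
  where "cell_le Y ord A c = {(a, b). a \<in> A \<and> b \<in> A \<and>
    (\<exists>x\<in>Y interior_of c a. \<exists>y\<in>Y interior_of c b. (x, y) \<in> ord)}"

definition cell_struct :: "'a topology \<Rightarrow> ('a \<times> 'a) set \<Rightarrow> 'i set \<Rightarrow> ('i \<Rightarrow> 'a set) \<Rightarrow> 'i lr_struct"
  where "cell_struct Y ord A c =
    \<lparr>lr_top = discrete_topology A, lr_R = cell_R A c, lr_le = cell_le Y ord A c\<rparr>"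

lemma cell_struct_simps [simp]:
  "lr_top (cell_struct Y ord A c) = discrete_topology A"
  "lr_R (cell_struct Y ord A c) = cell_R A c"
  "lr_le (cell_struct Y ord A c) = cell_le Y ord A c"
  by (simp_all add: cell_struct_def)

text \<open>The map \<open>s\<close> picks one thread of cells through each point. A boundary point
  lies on several threads, so comparable points may also lie on threads that are not comparable;
  \<open>section_mono\<close> makes the chosen ones comparable. \<open>le_lift\<close> is a separate
  demand because comparable interior points may fall on boundaries of the finer cells.\<close>

locale cell_system =
  fixes Y :: "'a topology" and ord :: "('a \<times> 'a) set"
    and I :: "nat \<Rightarrow> 'i set" and cell :: "nat \<Rightarrow> 'i \<Rightarrow> 'a set" and s :: "'a \<Rightarrow> nat \<Rightarrow> 'i"
  assumes compact: "compact_space Y" and Hausdorff: "Hausdorff_space Y"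
    and ord_closed: "closedin (prod_topology Y Y) ord"
    and finite_I: "finite (I n)"
    and regular: "a \<in> I n \<Longrightarrow> Y closure_of (Y interior_of cell n a) = cell n a"
    and nonempty: "a \<in> I n \<Longrightarrow> cell n a \<noteq> {}"
    and interiors_disjoint: "\<lbrakk>a \<in> I n; b \<in> I n; a \<noteq> b\<rbrakk> \<Longrightarrow>
      disjnt (Y interior_of cell n a) (Y interior_of cell n b)"
    and refine: "b \<in> I (Suc n) \<Longrightarrow> \<exists>a\<in>I n. cell (Suc n) b \<subseteq> cell n a"
    and separate: "\<lbrakk>x \<in> topspace Y; y \<in> topspace Y; x \<noteq> y\<rbrakk> \<Longrightarrow>
      \<exists>n. \<forall>a\<in>I n. \<not> (x \<in> cell n a \<and> y \<in> cell n a)"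
    and section_in: "x \<in> topspace Y \<Longrightarrow> s x n \<in> I n"
    and section_cell: "x \<in> topspace Y \<Longrightarrow> x \<in> cell n (s x n)"
    and section_nested: "x \<in> topspace Y \<Longrightarrow> cell (Suc n) (s x (Suc n)) \<subseteq> cell n (s x n)"
    and section_mono: "(x, y) \<in> ord \<Longrightarrow> (s x n, s y n) \<in> cell_le Y ord (I n) (cell n)"
    and le_lift: "(a, b) \<in> cell_le Y ord (I n) (cell n) \<Longrightarrow>
      \<exists>a' b'. (a', b') \<in> cell_le Y ord (I (Suc n)) (cell (Suc n)) \<and>
        cell (Suc n) a' \<subseteq> cell n a \<and> cell (Suc n) b' \<subseteq> cell n b"
begin

lemma ord_subset: "(x, y) \<in> ord \<Longrightarrow> x \<in> topspace Y \<and> y \<in> topspace Y"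
  using closedin_subset[OF ord_closed] by auto

lemma closedin_cell: "a \<in> I n \<Longrightarrow> closedin Y (cell n a)"
  by (metis regular closedin_closure_of)

lemma cell_subset: "a \<in> I n \<Longrightarrow> cell n a \<subseteq> topspace Y"
  using closedin_cell closedin_subset by blast

lemma interior_nonempty: "a \<in> I n \<Longrightarrow> Y interior_of cell n a \<noteq> {}"
  by (metis closure_of_empty nonempty regular)

text \<open>An open set that misses an interior also misses its closure, and by regularity that
  closure is the whole cell.\<close>

lemma interior_meets:
  assumes "a \<in> I n" "b \<in> I n" "x \<in> Y interior_of cell n a" "x \<in> cell n b"
  shows "a = b"
proof (rule ccontr)
  assume "a \<noteq> b"
  then have "Y interior_of cell n a \<inter> Y interior_of cell n b = {}"
    using interiors_disjoint assms by (simp add: disjnt_def)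
  then have "Y interior_of cell n a \<inter> Y closure_of (Y interior_of cell n b) = {}"
    by (simp add: openin_Int_closure_of_eq_empty)
  then show False
    using assms regular by auto
qed

text \<open>An interior point of the smaller cell is interior to one of the larger cells and lies in
  the other.\<close>

lemma parent_unique:
  assumes "b \<in> I m" "a \<in> I n" "a' \<in> I n" "cell m b \<subseteq> cell n a" "cell m b \<subseteq> cell n a'"
  shows "a = a'"
proof -
  obtain x where "x \<in> Y interior_of cell m b"
    using interior_nonempty assms by blast
  then have "x \<in> Y interior_of cell n a" "x \<in> cell n a'"
    using assms interior_of_mono interior_of_subset by (blast, metis in_mono interior_of_subset)
  then show ?thesis using interior_meets assms by blast
qed

lemma ex_ancestor: "n \<le> m \<Longrightarrow> b \<in> I m \<Longrightarrow> \<exists>a\<in>I n. cell m b \<subseteq> cell n a"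
proof (induction m arbitrary: b rule: dec_induct)
  case base
  then show ?case by blast
next
  case (step m)
  then show ?case using refine by (meson subset_trans)
qed

text \<open>Bonds across any number of levels are read off inclusion directly; compatibility with
  composition is then uniqueness of ancestors.\<close>

definition bond :: "nat \<Rightarrow> nat \<Rightarrow> 'i \<Rightarrow> 'i"
  where "bond n m b = (THE a. a \<in> I n \<and> cell m b \<subseteq> cell n a)"

lemma bond_eq: "b \<in> I m \<Longrightarrow> a \<in> I n \<Longrightarrow> cell m b \<subseteq> cell n a \<Longrightarrow> bond n m b = a"
  unfolding bond_def by (rule the_equality) (auto intro: parent_unique)

lemma bond_in: "n \<le> m \<Longrightarrow> b \<in> I m \<Longrightarrow> bond n m b \<in> I n"
  and bond_subset: "n \<le> m \<Longrightarrow> b \<in> I m \<Longrightarrow> cell m b \<subseteq> cell n (bond n m b)"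
  using ex_ancestor bond_eq by metis+

abbreviation (input) P :: "nat \<Rightarrow> 'i lr_struct"
  where "P n \<equiv> cell_struct Y ord (I n) (cell n)"

abbreviation (input) L :: "(nat \<Rightarrow> 'i) lr_struct"
  where "L \<equiv> projective_limit P bond"

text \<open>The children of \<open>a\<close> have a closed union. It contains every interior point
  \<open>x\<close> of the cell, because the parent of the finer cell chosen for \<open>x\<close> can
  only be \<open>a\<close>; by regularity it contains the whole cell.\<close>

lemma ex_child:
  assumes a: "a \<in> I n" and y: "y \<in> cell n a"
  shows "\<exists>b\<in>I (Suc n). y \<in> cell (Suc n) b \<and> cell (Suc n) b \<subseteq> cell n a"
proof -
  define B where "B = {b \<in> I (Suc n). cell (Suc n) b \<subseteq> cell n a}"
  have "closedin Y (\<Union>b\<in>B. cell (Suc n) b)"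
    using finite_I closedin_cell by (intro closedin_Union) (auto simp: B_def)
  moreover have "Y interior_of cell n a \<subseteq> (\<Union>b\<in>B. cell (Suc n) b)"
  proof
    fix x assume x: "x \<in> Y interior_of cell n a"
    then have xY: "x \<in> topspace Y"
      by (meson interior_of_subset_topspace subsetD)
    then have "x \<in> cell n (s x n)" by (rule section_cell)
    then have "a = s x n"
      using interior_meets a x section_in xY by blast
    then show "x \<in> (\<Union>b\<in>B. cell (Suc n) b)"
      using section_in[OF xY, of "Suc n"] section_cell[OF xY, of "Suc n"] section_nested[OF xY, of n]
      by (auto simp: B_def)
  qed
  ultimately have "cell n a \<subseteq> (\<Union>b\<in>B. cell (Suc n) b)"
    using regular[OF a] closure_of_minimal by metis
  then show ?thesis using y by (auto simp: B_def)
qed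

text \<open>For \<open>R\<close>, a point common to two cells is followed into a child of each. For
  \<open>\<le>\<close>, \<open>le_lift\<close> gives surjectivity, and monotonicity of interiors
  gives preservation.\<close>

lemma epimorphism_bond: "epimorphism (P (Suc n)) (P n) (bond n (Suc n))"
  unfolding epimorphism_def
proof (intro conjI)
  let ?f = "bond n (Suc n)"
  have f: "?f b \<in> I n" "cell (Suc n) b \<subseteq> cell n (?f b)" if "b \<in> I (Suc n)" for b
    using bond_in bond_subset that by simp_all
  show "continuous_map (lr_top (P (Suc n))) (lr_top (P n)) ?f"
    using f by auto
  have child: "\<exists>b\<in>I (Suc n). y \<in> cell (Suc n) b \<and> ?f b = a" if "a \<in> I n" "y \<in> cell n a" for a y
    using ex_child[OF that] bond_eq that by meson
  show "?f ` lr_carrier (P (Suc n)) = lr_carrier (P n)"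
    using f child nonempty by (fastforce simp: image_iff)
  show "lr_R (P n) = map_prod ?f ?f ` lr_R (P (Suc n))"
  proof
    show "lr_R (P n) \<subseteq> map_prod ?f ?f ` lr_R (P (Suc n))"
    proof clarify
      fix a b assume "(a, b) \<in> lr_R (P n)"
      then obtain y where ab: "a \<in> I n" "b \<in> I n" "y \<in> cell n a" "y \<in> cell n b"
        by (auto simp: cell_R_def)
      then obtain a' b' where "a' \<in> I (Suc n)" "y \<in> cell (Suc n) a'" "?f a' = a"
        "b' \<in> I (Suc n)" "y \<in> cell (Suc n) b'" "?f b' = b"
        using child by meson
      then show "(a, b) \<in> map_prod ?f ?f ` lr_R (P (Suc n))"
        by (force simp: cell_R_def image_iff)
    qed
    show "map_prod ?f ?f ` lr_R (P (Suc n)) \<subseteq> lr_R (P n)"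
      using f by (fastforce simp: cell_R_def)
  qed
  show "lr_le (P n) = map_prod ?f ?f ` lr_le (P (Suc n))"
  proof
    show "lr_le (P n) \<subseteq> map_prod ?f ?f ` lr_le (P (Suc n))"
    proof clarify
      fix a b assume ab: "(a, b) \<in> lr_le (P n)"
      then obtain a' b' where "(a', b') \<in> lr_le (P (Suc n))"
        "cell (Suc n) a' \<subseteq> cell n a" "cell (Suc n) b' \<subseteq> cell n b"
        using le_lift[of a b n] by (metis cell_struct_simps(3))
      moreover from this ab have "?f a' = a" "?f b' = b"
        by (auto simp: cell_le_def intro: bond_eq)
      ultimately show "(a, b) \<in> map_prod ?f ?f ` lr_le (P (Suc n))"
        by (metis map_prod_imageI)
    qed
    show "map_prod ?f ?f ` lr_le (P (Suc n)) \<subseteq> lr_le (P n)"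
    proof (rule image_subsetI)
      fix ab assume "ab \<in> lr_le (P (Suc n))"
      then obtain a b x y where ab: "ab = (a, b)" "a \<in> I (Suc n)" "b \<in> I (Suc n)" "(x, y) \<in> ord"
        "x \<in> Y interior_of cell (Suc n) a" "y \<in> Y interior_of cell (Suc n) b"
        by (auto simp: cell_le_def)
      then have "x \<in> Y interior_of cell n (?f a)" "y \<in> Y interior_of cell n (?f b)"
        using interior_of_mono[OF f(2)] by blast+
      then show "map_prod ?f ?f ab \<in> lr_le (P n)"
        using ab f(1) by (auto simp: cell_le_def)
    qed
  qed
qed

lemma projective_sequence_bond: "projective_sequence P bond"
  unfolding projective_sequence_def
proof (intro conjI allI ballI impI epimorphism_bond)
  show "bond n n x = x" if "x \<in> lr_carrier (P n)" for n x
    using that by (auto intro: bond_eq)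
  show "bond n (Suc m) x = bond n m (bond m (Suc m) x)"
    if "n \<le> m" "x \<in> lr_carrier (P (Suc m))" for n m x
  proof (rule bond_eq)
    have x: "x \<in> I (Suc m)" using that by simp
    then have "bond m (Suc m) x \<in> I m" by (simp add: bond_in)
    with that show "bond n m (bond m (Suc m) x) \<in> I n"
      by (simp add: bond_in)
    show "cell (Suc m) x \<subseteq> cell n (bond n m (bond m (Suc m) x))"
      using bond_subset[of m "Suc m" x] bond_subset[OF that(1) \<open>bond m (Suc m) x \<in> I m\<close>] x
      by simp
  qed (use that in simp)
qed

section \<open>Threads of nested cells and the points they determine\<close>

definition threads :: "(nat \<Rightarrow> 'i) set"
  where "threads = {u. \<forall>n. u n \<in> I n \<and> cell (Suc n) (u (Suc n)) \<subseteq> cell n (u n)}"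

lemma limit_points_eq: "limit_points P bond = threads"
proof -
  have "u n = bond n (Suc n) (u (Suc n)) \<longleftrightarrow> cell (Suc n) (u (Suc n)) \<subseteq> cell n (u n)"
    if "\<forall>n. u n \<in> I n" for u n
  proof
    have u: "u (Suc n) \<in> I (Suc n)" "u n \<in> I n" using that by auto
    show "cell (Suc n) (u (Suc n)) \<subseteq> cell n (u n)" if "u n = bond n (Suc n) (u (Suc n))"
      using bond_subset[OF _ u(1), of n] that by simp
    show "u n = bond n (Suc n) (u (Suc n))" if "cell (Suc n) (u (Suc n)) \<subseteq> cell n (u n)"
      using bond_eq[OF u that] by simp
  qed
  then show ?thesis
    unfolding limit_points_def threads_def PiE_UNIV_domain
    by (simp only: Pi_iff cell_struct_simps topspace_discrete_topology UNIV_I simp_thms) blast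
qed

lemma thread_in: "u \<in> threads \<Longrightarrow> u n \<in> I n"
  by (simp add: threads_def)

lemma thread_decseq: "u \<in> threads \<Longrightarrow> decseq (\<lambda>n. cell n (u n))"
  by (simp add: decseq_Suc_iff threads_def)

lemma thread_unique:
  assumes "u \<in> threads" "v \<in> threads" "n \<le> m" "u m = v m"
  shows "u n = v n"
proof (rule parent_unique)
  show "cell m (u m) \<subseteq> cell n (u n)" "cell m (u m) \<subseteq> cell n (v n)"
    using decseqD[OF thread_decseq[OF assms(1)] assms(3)]
      decseqD[OF thread_decseq[OF assms(2)] assms(3)] assms(4) by auto
qed (use assms thread_in in auto)

definition point :: "(nat \<Rightarrow> 'i) \<Rightarrow> 'a"
  where "point u = (THE y. \<forall>n. y \<in> cell n (u n))"

lemma point_eq: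
  assumes "u \<in> threads" "\<And>n. y \<in> cell n (u n)"
  shows "point u = y"
  unfolding point_def
proof (rule the_equality)
  fix z assume z: "\<forall>n. z \<in> cell n (u n)"
  show "z = y"
  proof (rule ccontr)
    assume "z \<noteq> y"
    moreover have "z \<in> topspace Y" "y \<in> topspace Y"
      using z assms cell_subset thread_in by blast+
    ultimately show False
      using separate z assms thread_in by meson
  qed
qed (use assms in blast)

lemma point_in: assumes "u \<in> threads" shows "point u \<in> cell n (u n)"
proof -
  have "(\<Inter>n. cell n (u n)) \<noteq> {}"
    using assms by (intro compact_space_imp_nest[OF compact] closedin_cell thread_in nonempty thread_decseq)
  then obtain y where y: "\<And>n. y \<in> cell n (u n)" by blast
  then show ?thesis using point_eq[OF assms y] by simp
qed

lemma point_in_topspace: "u \<in> threads \<Longrightarrow> point u \<in> topspace Y"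
  using point_in cell_subset thread_in by blast

lemma section_thread: "x \<in> topspace Y \<Longrightarrow> s x \<in> threads"
  by (simp add: threads_def section_in section_nested)

lemma point_section: "x \<in> topspace Y \<Longrightarrow> point (s x) = x"
  by (simp add: point_eq section_thread section_cell)

text \<open>Below \<open>n\<close> the thread consists of the ancestors of \<open>a\<close>; from
  \<open>n\<close> on, children containing \<open>y\<close> are chosen one after another.\<close>

lemma ex_thread_through:
  assumes a: "a \<in> I n" and y: "y \<in> cell n a"
  shows "\<exists>u\<in>threads. u n = a \<and> point u = y"
proof -
  \<comment> \<open>The offset \<open>k\<close> stands for level \<open>n + k\<close>; the clause
    for \<open>k = 0\<close> pins the start of the chosen sequence to \<open>a\<close>.\<close>
  define Q where "Q = (\<lambda>k b. b \<in> I (n + k) \<and> y \<in> cell (n + k) b \<and> (k = 0 \<longrightarrow> b = a))"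
  have "Q 0 a" using a y by (simp add: Q_def)
  moreover have "\<exists>b'. Q (Suc k) b' \<and> cell (n + Suc k) b' \<subseteq> cell (n + k) b" if "Q k b" for k b
    using ex_child[of b "n + k" y] that by (auto simp: Q_def)
  ultimately obtain v where v: "\<And>k. Q k (v k)"
    "\<And>k. cell (n + Suc k) (v (Suc k)) \<subseteq> cell (n + k) (v k)"
    using dependent_nat_choice[of Q "\<lambda>k b b'. cell (n + Suc k) b' \<subseteq> cell (n + k) b"] by metis
  define u where "u m = (if m < n then bond m n a else v (m - n))" for m
  have v0: "v 0 = a" using v(1)[of 0] by (simp add: Q_def)
  have u_ge: "u (n + k) = v k" for k
    by (simp add: u_def)
  have "u m \<in> I m \<and> y \<in> cell m (u m) \<and> cell (Suc m) (u (Suc m)) \<subseteq> cell m (u m)" for m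
  proof (cases "m < n")
    case True
    then have m: "u m \<in> I m" "cell n a \<subseteq> cell m (u m)"
      using a bond_in bond_subset by (simp_all add: u_def)
    moreover have "cell (Suc m) (u (Suc m)) \<subseteq> cell m (u m)"
    proof (cases "Suc m = n")
      case True
      then show ?thesis using v0 m by (auto simp: u_def)
    next
      case False
      then have "Suc m < n" using True by simp
      then have *: "bond (Suc m) n a \<in> I (Suc m)" "cell n a \<subseteq> cell (Suc m) (bond (Suc m) n a)"
        using a bond_in bond_subset by simp_all
      have "bond m n a = bond m (Suc m) (bond (Suc m) n a)"
      proof (rule bond_eq)
        show "cell n a \<subseteq> cell m (bond m (Suc m) (bond (Suc m) n a))"
          using * bond_subset[of m "Suc m" "bond (Suc m) n a"] by auto
      qed (use a * bond_in in auto)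
      then show ?thesis
        using bond_subset[OF _ *(1), of m] \<open>Suc m < n\<close> by (simp add: u_def)
    qed
    ultimately show ?thesis using y by auto
  next
    case False
    then obtain k where k: "m = n + k" by (metis le_add_diff_inverse linorder_not_less)
    show ?thesis
      using v(1)[of k] v(2)[of k] u_ge[of k] u_ge[of "Suc k"] by (simp add: k Q_def)
  qed
  then have "u \<in> threads" "\<And>m. y \<in> cell m (u m)" by (auto simp: threads_def)
  moreover have "u n = a" using u_ge[of 0] v0 by simp
  ultimately show ?thesis using point_eq by blast
qed

text \<open>If the cells of two threads meet at every level, compactness gives a point common to all
  of them, and each thread has only one point. So \<open>R\<close> is the kernel of
  \<open>point\<close>, which is why the sequence is fine.\<close>

lemma lr_R_limit: "lr_R L = {(u, v). u \<in> threads \<and> v \<in> threads \<and> point u = point v}"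
proof -
  have "(\<forall>n. (u n, v n) \<in> cell_R (I n) (cell n)) \<longleftrightarrow> point u = point v"
    if u: "u \<in> threads" and v: "v \<in> threads" for u v
  proof
    assume "\<forall>n. (u n, v n) \<in> cell_R (I n) (cell n)"
    then have ne: "\<And>n. cell n (u n) \<inter> cell n (v n) \<noteq> {}"
      by (auto simp: cell_R_def)
    have "(\<Inter>n. cell n (u n) \<inter> cell n (v n)) \<noteq> {}"
    proof (rule compact_space_imp_nest[OF compact _ ne])
      show "closedin Y (cell n (u n) \<inter> cell n (v n))" for n
        using closedin_cell thread_in u v by blast
      show "decseq (\<lambda>n. cell n (u n) \<inter> cell n (v n))"
        using thread_decseq[OF u] thread_decseq[OF v] unfolding decseq_def by blast
    qed
    then obtain z where "\<And>n. z \<in> cell n (u n)" "\<And>n. z \<in> cell n (v n)" by blast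
    then show "point u = point v" using point_eq u v by metis
  next
    assume "point u = point v"
    then show "\<forall>n. (u n, v n) \<in> cell_R (I n) (cell n)"
      using point_in[OF u] point_in[OF v] thread_in u v by (fastforce simp: cell_R_def)
  qed
  then show ?thesis by (auto simp: projective_limit_def limit_points_eq)
qed

lemma R_class_limit: "u \<in> threads \<Longrightarrow> R_class L u = {v \<in> threads. point v = point u}"
  by (auto simp: R_class_def lr_R_limit)

lemma topspace_limit: "lr_carrier L = threads"
  by (simp add: lr_carrier_projective_limit limit_points_eq)

lemma fine_projective_sequence_bond: "fine_projective_sequence P bond"
  unfolding fine_projective_sequence_def
proof
  show "equiv (lr_carrier L) (lr_R L)"
    unfolding lr_R_limit topspace_limit
    by (intro equivI refl_onI symI transI) auto
qed (rule projective_sequence_bond)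

section \<open>Topology of the limit and the quotient onto \<open>Y\<close>\<close>

lemma lr_top_limit:
  "lr_top L = subtopology (product_topology (\<lambda>n. discrete_topology (I n)) UNIV) threads"
  by (simp add: projective_limit_def limit_points_eq)

lemma openin_coordinate: "openin (lr_top L) {u \<in> threads. u n = a}"
proof -
  have "openin (lr_top L) {u \<in> topspace (lr_top L). u n \<in> {a} \<inter> I n}"
    unfolding lr_top_limit
    by (rule openin_continuous_map_preimage[of _ "discrete_topology (I n)"])
      (auto intro: continuous_map_from_subtopology continuous_map_product_projection)
  moreover have "{u \<in> topspace (lr_top L). u n \<in> {a} \<inter> I n} = {u \<in> threads. u n = a}"
    using thread_in by (auto simp: topspace_limit)
  ultimately show ?thesis by simp
qed

text \<open>A basic open set of the product restricts finitely many coordinates, and on threads the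
  last of these determines the earlier ones.\<close>

lemma coordinate_base:
  assumes U: "openin (lr_top L) U" and u: "u \<in> U"
  shows "\<exists>n. {v \<in> threads. v n = u n} \<subseteq> U"
proof -
  obtain V where V: "openin (product_topology (\<lambda>n. discrete_topology (I n)) UNIV) V"
    and UV: "U = V \<inter> threads"
    using U by (auto simp: lr_top_limit openin_subtopology)
  then obtain W where W: "finite {i. W i \<noteq> I i}" "u \<in> Pi\<^sub>E UNIV W" "Pi\<^sub>E UNIV W \<subseteq> V"
    using u by (auto simp: openin_product_topology_alt)
  \<comment> \<open>Inserting 0 covers the case that no coordinate is restricted.\<close>
  define n where "n = Max (insert 0 {i. W i \<noteq> I i})"
  have n: "i \<le> n" if "W i \<noteq> I i" for i
    using W(1) that by (auto simp: n_def)
  have "v \<in> U" if v: "v \<in> threads" "v n = u n" for v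
  proof -
    have uT: "u \<in> threads" using u UV by simp
    have "v i \<in> W i" for i
    proof (cases "W i = I i")
      case True
      then show ?thesis using v thread_in by simp
    next
      case False
      then have "v i = u i" using thread_unique[OF v(1) uT n] v(2) by simp
      then show ?thesis using W(2) by auto
    qed
    then show ?thesis using W(3) UV v(1) by (auto simp: PiE_UNIV_domain)
  qed
  then show ?thesis by blast
qed

text \<open>Threads are cut out of a compact product of finite discrete spaces by conditions
  \<open>?D n\<close> on consecutive coordinates, each a finite union of closed sets.\<close>

lemma compact_limit: "compact_space (lr_top L)"
proof -
  let ?X = "product_topology (\<lambda>n. discrete_topology (I n)) UNIV"
  have proj: "closedin ?X {u \<in> topspace ?X. u n = a}" for n a
  proof -
    have "closedin ?X {u \<in> topspace ?X. u n \<in> {a} \<inter> I n}"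
      by (rule closedin_continuous_map_preimage[of _ "discrete_topology (I n)"])
        (auto intro: continuous_map_product_projection)
    moreover have "{u \<in> topspace ?X. u n \<in> {a} \<inter> I n} = {u \<in> topspace ?X. u n = a}"
      by auto
    ultimately show ?thesis by simp
  qed
  let ?D = "\<lambda>n. \<Union>b\<in>I (Suc n). \<Union>a\<in>{a \<in> I n. cell (Suc n) b \<subseteq> cell n a}.
      {u \<in> topspace ?X. u (Suc n) = b} \<inter> {u \<in> topspace ?X. u n = a}"
  have "closedin ?X (?D n)" for n
    using finite_I[of n] finite_I[of "Suc n"]
    by (intro closedin_Union ballI finite_imageI; (elim imageE; hypsubst)?)
      (auto intro!: closedin_Union closedin_Int proj simp del: topspace_product_topology)
  then have "closedin ?X (\<Inter>n. ?D n)"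
    by blast
  moreover have "(\<Inter>n. ?D n) = threads"
    by (auto simp: threads_def PiE_UNIV_domain)
  ultimately have "closedin ?X threads" by simp
  moreover have "compact_space ?X"
    using finite_I by (simp add: compact_space_product_topology compact_space_discrete_topology)
  ultimately show ?thesis
    unfolding lr_top_limit by (simp add: closedin_compact_space compact_space_subtopology)
qed

text \<open>Otherwise the parts of the cells outside \<open>V\<close> are a decreasing sequence of
  nonempty closed sets, and a common point would be a second point of the thread.\<close>

lemma cell_small:
  assumes u: "u \<in> threads" and V: "openin Y V" "point u \<in> V"
  shows "\<exists>n. \<forall>m\<ge>n. cell m (u m) \<subseteq> V"
proof -
  have "\<exists>n. cell n (u n) - V = {}"
  proof (rule ccontr)
    assume "\<not> ?thesis"
    then have ne: "\<And>n. cell n (u n) - V \<noteq> {}" by blast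
    have "(\<Inter>n. cell n (u n) - V) \<noteq> {}"
    proof (rule compact_space_imp_nest[OF compact _ ne])
      show "closedin Y (cell n (u n) - V)" for n
        using closedin_cell thread_in u V by blast
      show "decseq (\<lambda>n. cell n (u n) - V)"
        using thread_decseq[OF u] unfolding decseq_def by blast
    qed
    then obtain z where "\<And>n. z \<in> cell n (u n)" "z \<notin> V" by blast
    then show False using point_eq[OF u] V by metis
  qed
  then obtain n where n: "cell n (u n) \<subseteq> V" by blast
  have "cell m (u m) \<subseteq> V" if "m \<ge> n" for m
    using decseqD[OF thread_decseq[OF u] that] n by blast
  then show ?thesis by blast
qed

lemma continuous_point: "continuous_map (lr_top L) Y point"
  unfolding continuous_map_def
proof (intro conjI allI impI)
  show "point \<in> topspace (lr_top L) \<rightarrow> topspace Y"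
    by (simp add: topspace_limit point_in_topspace)
  fix V assume V: "openin Y V"
  show "openin (lr_top L) {u \<in> topspace (lr_top L). point u \<in> V}"
  proof (subst openin_subopen, clarify)
    fix u assume "u \<in> topspace (lr_top L)" and uV: "point u \<in> V"
    then have u: "u \<in> threads" by (simp add: topspace_limit)
    then obtain n where "\<forall>m\<ge>n. cell m (u m) \<subseteq> V" using cell_small[OF _ V uV] by blast
    then have "cell n (u n) \<subseteq> V" by simp
    then have "{v \<in> threads. v n = u n} \<subseteq> {u \<in> topspace (lr_top L). point u \<in> V}"
      using point_in[of _ n] by (fastforce simp: topspace_limit)
    then show "\<exists>T. openin (lr_top L) T \<and> u \<in> T \<and> T \<subseteq> {u \<in> topspace (lr_top L). point u \<in> V}"
      using openin_coordinate u by blast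
  qed
qed

lemma point_surj: "point ` threads = topspace Y"
  using point_in_topspace section_thread point_section by force

lemma quotient_point: "quotient_map (lr_top L) Y point"
proof (rule continuous_closed_imp_quotient_map[OF continuous_point])
  show "closed_map (lr_top L) Y point"
    using continuous_imp_closed_map[OF continuous_point compact_limit Hausdorff] .
qed (simp add: topspace_limit point_surj)

text \<open>On a class of threads \<open>point\<close> is constant, so the choice of the
  representative does not matter.\<close>

definition class_point :: "(nat \<Rightarrow> 'i) set \<Rightarrow> 'a"
  where "class_point C = point (SOME u. u \<in> C)"

lemma class_point: assumes "u \<in> threads" shows "class_point (R_class L u) = point u"
proof -
  have "u \<in> R_class L u" using assms by (simp add: R_class_limit)
  then have "(SOME v. v \<in> R_class L u) \<in> R_class L u" by (metis someI)
  then show ?thesis using assms by (simp add: R_class_limit class_point_def)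
qed

lemma topspace_quotient: "topspace (R_quotient L) = R_class L ` threads"
  by (simp add: R_quotient_def topspace_quotient_topology topspace_limit)

text \<open>\<open>R_class L\<close> and \<open>point\<close> are quotient maps from the limit with
  the same fibres.\<close>

lemma homeomorphic_class_point: "homeomorphic_map (R_quotient L) Y class_point"
  unfolding homeomorphic_map_def
proof
  have q: "quotient_map (lr_top L) (R_quotient L) (R_class L)"
    unfolding R_quotient_def by (rule quotient_map_quotient_topology)
  have eq: "(class_point \<circ> R_class L) u = point u" if "u \<in> topspace (lr_top L)" for u
    using that class_point by (simp add: topspace_limit)
  have "continuous_map (R_quotient L) Y class_point"
    by (rule continuous_compose_quotient_map[OF q continuous_map_eq[OF continuous_point eq[symmetric]]])
  moreover have "quotient_map (lr_top L) Y (class_point \<circ> R_class L)"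
    by (rule quotient_map_eq[OF quotient_point eq[symmetric]])
  ultimately show "quotient_map (R_quotient L) Y class_point"
    using quotient_map_from_composition q quotient_imp_continuous_map by blast
  show "inj_on class_point (topspace (R_quotient L))"
    unfolding topspace_quotient
  proof (rule inj_onI, clarify)
    fix u v assume "u \<in> threads" "v \<in> threads"
      and "class_point (R_class L u) = class_point (R_class L v)"
    then show "R_class L u = R_class L v"
      using class_point[of u] class_point[of v] by (simp add: R_class_limit)
  qed
qed

lemma point_coordinate: assumes "a \<in> I n" shows "point ` {u \<in> threads. u n = a} = cell n a"
  using ex_thread_through[OF assms] point_in[of _ n] by fastforce

text \<open>The complement of \<open>K\<close> contains a cylinder given by
  \<open>v n = u n\<close>. A point \<open>z\<close> interior to the cell of \<open>u n\<close> lies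
  in no other cell of level \<open>n\<close>, so every thread through \<open>z\<close> is in this
  cylinder and \<open>K\<close> misses the class of \<open>z\<close>.\<close>

lemma irreducible_R_class: "irreducible_map (lr_top L) (R_quotient L) (R_class L)"
  unfolding irreducible_map_def
proof (intro conjI allI impI notI)
  show "continuous_map (lr_top L) (R_quotient L) (R_class L)"
    unfolding R_quotient_def by (rule quotient_imp_continuous_map[OF quotient_map_quotient_topology])
  fix K assume K: "closedin (lr_top L) K \<and> K \<subset> topspace (lr_top L)"
    and im: "R_class L ` K = topspace (R_quotient L)"
  then obtain u where u: "u \<in> threads - K" by (auto simp: topspace_limit)
  have "openin (lr_top L) (threads - K)"
    using K unfolding closedin_def topspace_limit by simp
  then obtain n where n: "{v \<in> threads. v n = u n} \<subseteq> threads - K"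
    using coordinate_base u by blast
  obtain z where z: "z \<in> Y interior_of cell n (u n)"
    using interior_nonempty thread_in u by blast
  then have zY: "z \<in> topspace Y" by (meson interior_of_subset_topspace subsetD)
  have "R_class L (s z) \<in> R_class L ` K"
    unfolding im topspace_quotient using section_thread zY by blast
  then obtain v where v: "v \<in> K" "R_class L (s z) = R_class L v" by blast
  then have vT: "v \<in> threads" using K by (auto simp: topspace_limit)
  then have "point v = z"
    using arg_cong[OF v(2), of class_point] class_point[OF vT] class_point[OF section_thread[OF zY]]
      point_section[OF zY] by (simp only:)
  then have "z \<in> cell n (v n)" using point_in[OF vT, of n] by simp
  then have "u n = v n" using interior_meets[OF _ _ z] thread_in u vT by simp
  then have "v \<in> {v \<in> threads. v n = u n}" using vT by simp
  then show False using n v(1) by blast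
qed

text \<open>From left to right: a pair outside the closed relation has a box neighbourhood missing
  it, and the cells of both threads end up inside this box although they contain related points.
  From right to left: the threads chosen by \<open>s\<close> are comparable at every level.\<close>

lemma quotient_order_iff:
  assumes "x \<in> topspace (R_quotient L)" "y \<in> topspace (R_quotient L)"
  shows "(x, y) \<in> R_quotient_le L \<longleftrightarrow> (class_point x, class_point y) \<in> ord"
proof
  assume "(x, y) \<in> R_quotient_le L"
  then obtain u v where uv: "(u, v) \<in> lr_le L" "x = R_class L u" "y = R_class L v"
    by (auto simp: R_quotient_le_def)
  then have T: "u \<in> threads" "v \<in> threads" and le: "\<And>n. (u n, v n) \<in> cell_le Y ord (I n) (cell n)"
    by (auto simp: projective_limit_def limit_points_eq)
  have "(point u, point v) \<in> ord"
  proof (rule ccontr)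
    assume "(point u, point v) \<notin> ord"
    then have "(point u, point v) \<in> topspace (prod_topology Y Y) - ord"
      using T point_in_topspace by simp
    moreover have "openin (prod_topology Y Y) (topspace (prod_topology Y Y) - ord)"
      using ord_closed by blast
    ultimately obtain A B where AB: "openin Y A" "openin Y B" "point u \<in> A" "point v \<in> B"
      "A \<times> B \<subseteq> topspace (prod_topology Y Y) - ord"
      unfolding openin_prod_topology_alt by meson
    obtain i j where "\<forall>m\<ge>i. cell m (u m) \<subseteq> A" "\<forall>m\<ge>j. cell m (v m) \<subseteq> B"
      using cell_small T AB by meson
    then have "cell (max i j) (u (max i j)) \<subseteq> A" "cell (max i j) (v (max i j)) \<subseteq> B" by auto
    moreover obtain x y where "x \<in> cell (max i j) (u (max i j))" "y \<in> cell (max i j) (v (max i j))"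
      "(x, y) \<in> ord"
      using le[of "max i j"] interior_of_subset by (fastforce simp: cell_le_def)
    ultimately show False using AB(5) by blast
  qed
  then show "(class_point x, class_point y) \<in> ord"
    using uv class_point T by simp
next
  assume o: "(class_point x, class_point y) \<in> ord"
  define a b where "a = class_point x" "b = class_point y"
  have ab: "a \<in> topspace Y" "b \<in> topspace Y" using ord_subset o by (auto simp: a_b_def)
  have "(s a, s b) \<in> lr_le L"
    using section_thread ab section_mono o by (auto simp: a_b_def projective_limit_def limit_points_eq)
  moreover have "R_class L (s (class_point z)) = z" if "z \<in> topspace (R_quotient L)" for z
  proof -
    obtain u where "u \<in> threads" "z = R_class L u" using \<open>z \<in> _\<close> by (auto simp: topspace_quotient)
    then show ?thesis
      using class_point section_thread point_section point_in_topspace by (simp add: R_class_limit)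
  qed
  ultimately show "(x, y) \<in> R_quotient_le L"
    using assms map_prod_imageI[of "s a" "s b" "lr_le L" "R_class L" "R_class L"]
    unfolding R_quotient_le_def by (simp add: a_b_def)
qed

text \<open>The image of a cylinder under \<open>point\<close> is the whole cell, and homeomorphisms
  preserve interiors; this carries the definition of \<open>cell_le\<close> over to the
  quotient.\<close>

lemma class_point_interior:
  assumes "a \<in> I n"
  shows "class_point ` (R_quotient L interior_of (R_class L ` {u \<in> lr_carrier L. u n = a}))
    = Y interior_of cell n a"
proof -
  let ?S = "R_class L ` {u \<in> threads. u n = a}"
  have "Y interior_of (class_point ` ?S) = class_point ` (R_quotient L interior_of ?S)"
    by (rule homeomorphic_map_interior_of[OF homeomorphic_class_point])
      (auto simp: topspace_quotient)
  moreover have "class_point ` ?S = point ` {u \<in> threads. u n = a}"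
    by (auto simp: image_image class_point)
  ultimately show ?thesis by (simp add: topspace_limit point_coordinate assms)
qed

theorem limit_representation:
  "fine_projective_sequence P bond \<and>
    (let L = projective_limit P bond;
         Q = R_quotient L;
         p = R_class L;
         int_cell = (\<lambda>n a. Q interior_of (p ` {u \<in> lr_carrier L. u n = a}))
     in irreducible_map (lr_top L) Q p \<and>
        (\<exists>g. homeomorphic_map Q Y g \<and>
          (\<forall>x\<in>topspace Q. \<forall>y\<in>topspace Q. (x, y) \<in> R_quotient_le L \<longleftrightarrow> (g x, g y) \<in> ord) \<and>
          (\<forall>n. \<forall>a\<in>lr_carrier (P n). \<forall>a'\<in>lr_carrier (P n).
            (a, a') \<in> lr_le (P n) \<longleftrightarrow>
            (\<exists>x\<in>int_cell n a. \<exists>x'\<in>int_cell n a'. (g x, g x') \<in> ord))))"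
proof -
  have "(a, a') \<in> lr_le (P n) \<longleftrightarrow>
      (\<exists>x\<in>R_quotient L interior_of (R_class L ` {u \<in> lr_carrier L. u n = a}).
       \<exists>x'\<in>R_quotient L interior_of (R_class L ` {u \<in> lr_carrier L. u n = a'}).
         (class_point x, class_point x') \<in> ord)"
    if "a \<in> I n" "a' \<in> I n" for n a a'
  proof -
    have "(a, a') \<in> lr_le (P n) \<longleftrightarrow>
        (\<exists>x\<in>Y interior_of cell n a. \<exists>x'\<in>Y interior_of cell n a'. (x, x') \<in> ord)"
      using that by (simp add: cell_le_def)
    then show ?thesis
      by (simp only: class_point_interior[OF that(1), symmetric]
          class_point_interior[OF that(2), symmetric] bex_simps)
  qed
  then show ?thesis
    unfolding Let_def
    using irreducible_R_class homeomorphic_class_point quotient_order_iff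
    by (intro conjI fine_projective_sequence_bond exI[of _ class_point] ballI allI) simp_all
qed

end

section \<open>Monotone functions on compact ordered spaces\<close>


text \<open>Compactness gives a finite net for each radius \<open>1 / Suc n\<close>; the balls about
  all these nets are a countable base.\<close>

lemma compact_metrizable_imp_second_countable:
  assumes "compact_space X" "metrizable_space X"
  shows "second_countable X"
proof -
  obtain M d where "Metric_space M d" and X: "X = Metric_space.mtopology M d"
    using assms(2) metrizable_space_def by metis
  interpret Metric_space M d by fact
  have "mtotally_bounded M"
    using assms(1) compactin_imp_mtotally_bounded[of M]
    by (simp add: X compact_space_def)
  then have "\<forall>n. \<exists>K. finite K \<and> K \<subseteq> M \<and> M \<subseteq> (\<Union>x\<in>K. mball x (1 / Suc n))"
    unfolding mtotally_bounded_def by simp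
  then obtain K where K: "\<And>n::nat. finite (K n)" "\<And>n. K n \<subseteq> M"
    "\<And>n. M \<subseteq> (\<Union>x\<in>K n. mball x (1 / Suc n))"
    by metis
  show ?thesis
    unfolding second_countable_def X
  proof (intro exI[of _ "\<Union>n. (\<lambda>x. mball x (1 / Suc n)) ` K n"] conjI allI impI ballI)
    show "countable (\<Union>n. (\<lambda>x. mball x (1 / real (Suc n))) ` K n)"
      by (rule countable_UN[OF countableI_type countable_image[OF countable_finite[OF K(1)]]])
    show "openin mtopology V" if "V \<in> (\<Union>n. (\<lambda>x. mball x (1 / Suc n)) ` K n)" for V
      using that by auto
    fix U x assume "openin mtopology U \<and> x \<in> U"
    then obtain r where r: "r > 0" "mball x r \<subseteq> U" and x: "x \<in> M"
      by (metis openin_mtopology subsetD)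
    obtain n :: nat where n: "1 / Suc n < r / 2"
      using r(1) nat_approx_posE[of "r / 2"] by auto
    obtain y where y: "y \<in> K n" "x \<in> mball y (1 / Suc n)"
      using K(3)[of n] x by blast
    have "mball y (1 / Suc n) \<subseteq> mball x r"
    proof
      fix z assume z: "z \<in> mball y (1 / Suc n)"
      then have "d x z \<le> d y x + d y z" using y triangle'[of x y z] by (simp add: commute)
      then show "z \<in> mball x r" using z y n by simp
    qed
    then show "\<exists>V\<in>\<Union>n. (\<lambda>x. mball x (1 / Suc n)) ` K n. x \<in> V \<and> V \<subseteq> U"
      using y r(2) by blast
  qed
qed

definition clopenin :: "'a topology \<Rightarrow> 'a set \<Rightarrow> bool"
  where "clopenin X W \<longleftrightarrow> openin X W \<and> closedin X W"

lemma clopenin_subset: "clopenin X W \<Longrightarrow> W \<subseteq> topspace X"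
  by (simp add: clopenin_def openin_subset)

lemma clopenin_topspace: "clopenin X (topspace X)"
  by (simp add: clopenin_def)

lemma clopenin_Int: "clopenin X V \<Longrightarrow> clopenin X W \<Longrightarrow> clopenin X (V \<inter> W)"
  by (auto simp: clopenin_def)

lemma clopenin_diff: "clopenin X V \<Longrightarrow> clopenin X W \<Longrightarrow> clopenin X (V - W)"
  by (simp add: clopenin_def openin_diff closedin_diff)

text \<open>A clopen set is compact and open, hence a finite union of members of a countable
  base.\<close>

lemma countable_clopenin:
  assumes "compact_space X" "second_countable X"
  shows "countable {W. clopenin X W}"
proof -
  obtain \<B> where \<B>: "countable \<B>" "\<And>V. V \<in> \<B> \<Longrightarrow> openin X V"
    "\<And>U x. openin X U \<Longrightarrow> x \<in> U \<Longrightarrow> \<exists>V\<in>\<B>. x \<in> V \<and> V \<subseteq> U"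
    using assms(2) unfolding second_countable_def by metis
  have "{W. clopenin X W} \<subseteq> Union ` {\<F>. finite \<F> \<and> \<F> \<subseteq> \<B>}"
  proof
    fix W assume "W \<in> {W. clopenin X W}"
    then have W: "openin X W" "compactin X W"
      using assms(1) by (auto simp: clopenin_def closedin_compact_space)
    have "W \<subseteq> \<Union>{V \<in> \<B>. V \<subseteq> W}" using \<B>(3)[OF W(1)] by blast
    then obtain \<F> where "finite \<F>" "\<F> \<subseteq> {V \<in> \<B>. V \<subseteq> W}" "W \<subseteq> \<Union>\<F>"
      using compactinD[OF W(2), of "{V \<in> \<B>. V \<subseteq> W}"] \<B>(2) by blast
    then have "W = \<Union>\<F>" "finite \<F> \<and> \<F> \<subseteq> \<B>" by auto
    then show "W \<in> Union ` {\<F>. finite \<F> \<and> \<F> \<subseteq> \<B>}" by blast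
  qed
  then show ?thesis
    using countable_image[OF countable_Collect_finite_subset[OF \<B>(1)]] by (rule countable_subset)
qed

lemma dyadic_between:
  fixes a b :: real
  assumes "0 \<le> a" "a < b" "b \<le> 1"
  shows "\<exists>r\<in>dyadics \<inter> {0..1}. a < r \<and> r < b"
proof -
  obtain n where n: "(1/2::real) ^ n < b - a"
    using real_arch_pow_inv[of "b - a" "1/2"] assms by auto
  define k where "k = nat (\<lfloor>a * 2 ^ n\<rfloor> + 1)"
  have k: "real k = of_int \<lfloor>a * 2 ^ n\<rfloor> + 1"
    using assms by (simp add: k_def)
  have "a * 2 ^ n < real k" "real k \<le> a * 2 ^ n + 1"
    unfolding k by linarith+
  moreover have "a * 2 ^ n + 1 < b * 2 ^ n"
    using n by (simp add: field_simps)
  ultimately have "a < real k / 2 ^ n" "real k / 2 ^ n < b"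
    by (simp_all add: field_simps)
  then have "a < real k / 2 ^ n \<and> real k / 2 ^ n < b" "real k / 2 ^ n \<in> {0..1}"
    using assms by (simp, simp only: atLeastAtMost_iff) linarith
  moreover have "real k / 2 ^ n \<in> dyadics"
    unfolding dyadics_def by blast
  ultimately show ?thesis by blast
qed

locale compact_ordered_space =
  fixes Y :: "'a topology" and ord :: "('a \<times> 'a) set"
  assumes compact: "compact_space Y" and metrizable: "metrizable_space Y"
    and order: "closed_partial_order Y ord"
begin

lemma Hausdorff: "Hausdorff_space Y"
  by (simp add: metrizable metrizable_imp_Hausdorff_space)

lemma second_countable: "second_countable Y"
  using compact compact_metrizable_imp_second_countable metrizable by blast

lemma ord_closed: "closedin (prod_topology Y Y) ord"
  using order by (simp add: closed_partial_order_def)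

lemma ord_in: "(x, y) \<in> ord \<Longrightarrow> x \<in> topspace Y" "(x, y) \<in> ord \<Longrightarrow> y \<in> topspace Y"
  using closedin_subset[OF ord_closed] by auto

lemma ord_refl: "x \<in> topspace Y \<Longrightarrow> (x, x) \<in> ord"
  using order by (auto simp: closed_partial_order_def partial_order_on_def preorder_on_def refl_on_def)

lemma ord_trans: "(x, y) \<in> ord \<Longrightarrow> (y, z) \<in> ord \<Longrightarrow> (x, z) \<in> ord"
  using order by (auto simp: closed_partial_order_def partial_order_on_def preorder_on_def dest: transD)

lemma ord_antisym: "(x, y) \<in> ord \<Longrightarrow> (y, x) \<in> ord \<Longrightarrow> x = y"
  using order by (auto simp: closed_partial_order_def partial_order_on_def dest: antisymD)

text \<open>Projections along a compact factor are closed maps.\<close>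

lemma closedin_ord_Image:
  assumes "closedin Y A"
  shows "closedin Y (ord `` A)" "closedin Y (ord\<inverse> `` A)"
proof -
  have "closedin (prod_topology Y Y) (ord \<inter> A \<times> topspace Y)"
    "closedin (prod_topology Y Y) (ord \<inter> topspace Y \<times> A)"
    using assms ord_closed by (simp_all add: closedin_Int closedin_prod_Times_iff)
  then have "closedin Y (snd ` (ord \<inter> A \<times> topspace Y))" "closedin Y (fst ` (ord \<inter> topspace Y \<times> A))"
    using closed_map_fst[OF compact] closed_map_snd[OF compact] by (auto simp: closed_map_def)
  moreover have "snd ` (ord \<inter> A \<times> topspace Y) = ord `` A" "fst ` (ord \<inter> topspace Y \<times> A) = ord\<inverse> `` A"
    using ord_in by force+
  ultimately show "closedin Y (ord `` A)" "closedin Y (ord\<inverse> `` A)" by simp_all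
qed

section \<open>Isotone Urysohn functions and a strictly isotone height\<close>

definition lower :: "'a set \<Rightarrow> bool"
  where "lower U \<longleftrightarrow> ord\<inverse> `` U \<subseteq> U"

lemma lowerD: "lower U \<Longrightarrow> (x, y) \<in> ord \<Longrightarrow> y \<in> U \<Longrightarrow> x \<in> U"
  by (auto simp: lower_def)

text \<open>Nachbin's form of normality. With an ordinary neighbourhood \<open>N\<close> from
  normality, \<open>W\<close> is the largest lower subset of \<open>N\<close> and \<open>D\<close>
  the lower set generated by the closure of \<open>N\<close>; up-sets and down-sets of closed sets
  being closed, \<open>W\<close> is open and \<open>D\<close> closed.\<close>

lemma lower_interpolation:
  assumes C: "closedin Y C" "lower C" and V: "openin Y V" "lower V" and "C \<subseteq> V"
  obtains W D where "openin Y W" "lower W" "closedin Y D" "lower D" "C \<subseteq> W" "W \<subseteq> D" "D \<subseteq> V"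
proof -
  have "normal_space Y"
    using compact Hausdorff compact_Hausdorff_or_regular_imp_normal_space by blast
  then obtain N where N: "openin Y N" "C \<subseteq> N" "Y closure_of N \<subseteq> V"
    using assms unfolding normal_space_alt by meson
  show thesis
  proof
    show "openin Y (topspace Y - ord `` (topspace Y - N))"
      using closedin_ord_Image(1) N(1) by blast
    show "lower (topspace Y - ord `` (topspace Y - N))"
      unfolding lower_def using ord_in ord_trans by blast
    show "closedin Y (ord\<inverse> `` (Y closure_of N))"
      using closedin_ord_Image(2) by simp
    show "lower (ord\<inverse> `` (Y closure_of N))"
      unfolding lower_def using ord_trans by blast
    show "C \<subseteq> topspace Y - ord `` (topspace Y - N)"
      using closedin_subset[OF C(1)] lowerD[OF C(2)] N(2) by blast
    show "topspace Y - ord `` (topspace Y - N) \<subseteq> ord\<inverse> `` (Y closure_of N)"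
      using ord_refl closure_of_subset[OF openin_subset[OF N(1)]] by blast
    show "ord\<inverse> `` (Y closure_of N) \<subseteq> V"
      using N(3) lowerD[OF V(2)] by blast
  qed
qed

definition isotone :: "('a \<Rightarrow> real) \<Rightarrow> bool"
  where "isotone f \<longleftrightarrow> (\<forall>x y. (x, y) \<in> ord \<longrightarrow> f x \<le> f y)"

text \<open>Urysohn's construction with lower sets: the infimum is isotone because every
  \<open>G r\<close> is lower.\<close>

lemma ordered_Urysohn:
  assumes S: "closedin Y S" "lower S" and T: "closedin Y T" "lower (topspace Y - T)"
    and disj: "S \<inter> T = {}"
  obtains f where "continuous_map Y euclideanreal f" "isotone f"
    "\<And>x. 0 \<le> f x \<and> f x \<le> 1" "\<And>x. x \<in> S \<Longrightarrow> f x = 0" "\<And>x. x \<in> T \<Longrightarrow> f x = 1"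
proof -
  \<comment> \<open>The relation carries openness and lowerness through the dyadic recursion; the
    closed set in between keeps the closure of \<open>U\<close> inside \<open>V\<close>.\<close>
  define R where "R U V \<longleftrightarrow> openin Y U \<and> openin Y V \<and> lower U \<and> lower V \<and>
    (\<exists>C. closedin Y C \<and> lower C \<and> U \<subseteq> C \<and> C \<subseteq> V)" for U V
  obtain U D where U: "openin Y U" "lower U" "closedin Y D" "lower D" "S \<subseteq> U" "U \<subseteq> D" "D \<subseteq> topspace Y - T"
    using lower_interpolation[OF S, of "topspace Y - T"] T disj closedin_subset[OF S(1)] by blast
  have "\<exists>G :: real \<Rightarrow> 'a set. G 0 = U \<and> G 1 = topspace Y - T \<and>
      (\<forall>x \<in> dyadics \<inter> {0..1}. \<forall>y \<in> dyadics \<inter> {0..1}. x < y \<longrightarrow> R (G x) (G y))"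
  proof (rule recursion_on_dyadic_fractions)
    show "R U (topspace Y - T)"
      unfolding R_def using U T by blast
    show "\<exists>W. R U W \<and> R W V" if "R U V" for U V
    proof -
      from that obtain C where UV: "openin Y U" "openin Y V" "lower U" "lower V"
        and C: "closedin Y C" "lower C" "U \<subseteq> C" "C \<subseteq> V"
        unfolding R_def by blast
      obtain W D where "openin Y W" "lower W" "closedin Y D" "lower D" "C \<subseteq> W" "W \<subseteq> D" "D \<subseteq> V"
        using lower_interpolation[OF C(1,2) UV(2,4) C(4)] .
      then show ?thesis unfolding R_def using UV C by blast
    qed
    show "R U W" if "R U V" "R V W" for U V W
      using that unfolding R_def by blast
  qed
  then obtain G :: "real \<Rightarrow> 'a set" where G0: "G 0 = U" and G1: "G 1 = topspace Y - T"
    and R: "\<And>r s. \<lbrakk>r \<in> dyadics \<inter> {0..1}; s \<in> dyadics \<inter> {0..1}; r < s\<rbrakk> \<Longrightarrow> R (G r) (G s)"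
    by auto
  let ?D = "dyadics \<inter> {0..1::real}"
  have 01: "0 \<in> ?D" "1 \<in> ?D"
    by (force simp: dyadics_def)+
  have G: "openin Y (G r)" "lower (G r)" if "r \<in> ?D" for r
  proof -
    have "r < 1 \<or> 0 < r" using that by auto
    then show "openin Y (G r)" "lower (G r)"
      using R[OF that 01(2)] R[OF 01(1) that] unfolding R_def by blast+
  qed
  have Gsub: "Y closure_of G r \<subseteq> G s" "G r \<subseteq> G s" if rs: "r \<in> ?D" "s \<in> ?D" "r < s" for r s
  proof -
    obtain C where "closedin Y C" "G r \<subseteq> C" "C \<subseteq> G s"
      using R[OF rs] unfolding R_def by blast
    then show "Y closure_of G r \<subseteq> G s" "G r \<subseteq> G s"
      using closure_of_minimal by blast+
  qed
  \<comment> \<open>The value 1 is inserted for points in no \<open>G r\<close>, among them those of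
    \<open>T\<close>.\<close>
  define f where "f x = Inf (insert 1 {r \<in> ?D. x \<in> G r})" for x
  have bdd: "bdd_below (insert 1 {r \<in> ?D. x \<in> G r})" for x
    by (rule bdd_belowI[of _ 0]) auto
  have f_less: "f x < t \<longleftrightarrow> 1 < t \<or> (\<exists>r\<in>?D. r < t \<and> x \<in> G r)" for x t
    unfolding f_def using bdd[of x] by (subst cInf_less_iff) auto
  have f_ge: "f x \<ge> c" if "c \<le> 1" "\<And>r. r \<in> ?D \<Longrightarrow> x \<in> G r \<Longrightarrow> c \<le> r" for x c
    unfolding f_def by (rule cInf_greatest) (use that in auto)
  have f_le: "f x \<le> r" if "r \<in> ?D" "x \<in> G r" for x r
    unfolding f_def using that bdd[of x] by (intro cInf_lower) auto
  have f01: "0 \<le> f x \<and> f x \<le> 1" for x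
    using f_ge[of 0 x] f_less[of x 1] unfolding f_def by (auto intro!: cInf_lower bdd)
  have f_greater: "t < f x \<longleftrightarrow> t < 0 \<or> (\<exists>r\<in>?D. t < r \<and> x \<notin> Y closure_of G r)"
    if x: "x \<in> topspace Y" for x t
  proof
    assume t: "t < f x"
    show "t < 0 \<or> (\<exists>r\<in>?D. t < r \<and> x \<notin> Y closure_of G r)"
    proof (cases "t < 0")
      case False
      \<comment> \<open>Two dyadics, because \<open>x\<close> is first seen to be outside
        \<open>G q\<close>, and only the closure of an earlier \<open>G r\<close> is contained in
        \<open>G q\<close>.\<close>
      obtain q where q: "q \<in> ?D" "t < q" "q < f x"
        using dyadic_between[of t "f x"] False t f01[of x] by auto
      obtain r where r: "r \<in> ?D" "t < r" "r < q"
        using dyadic_between[of t q] False q by auto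
      have "x \<notin> G q" using f_le[OF q(1)] q(3) by force
      then have "x \<notin> Y closure_of G r" using Gsub(1)[OF r(1) q(1) r(3)] by blast
      then show ?thesis using r by blast
    qed simp
  next
    assume "t < 0 \<or> (\<exists>r\<in>?D. t < r \<and> x \<notin> Y closure_of G r)"
    then show "t < f x"
    proof
      assume "\<exists>r\<in>?D. t < r \<and> x \<notin> Y closure_of G r"
      then obtain r where r: "r \<in> ?D" "t < r" "x \<notin> Y closure_of G r" by blast
      then have "x \<notin> G r" using closure_of_subset[OF openin_subset[OF G(1)[OF r(1)]]] by blast
      then have "r \<le> f x"
      proof (intro f_ge)
        fix q assume q: "q \<in> ?D" "x \<in> G q"
        then show "r \<le> q" using Gsub(2)[OF q(1) r(1)] \<open>x \<notin> G r\<close> by (meson not_le subsetD)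
      qed (use r in auto)
      then show "t < f x" using r by simp
    qed (use f01[of x] in auto)
  qed
  show thesis
  proof
    show "continuous_map Y euclideanreal f"
      unfolding continuous_map_upper_lower_semicontinuous_lt
    proof (intro allI conjI)
      fix t
      have "openin Y (\<Union>r\<in>{r\<in>?D. t < r}. topspace Y - Y closure_of G r)"
        by (intro openin_Union) auto
      moreover have "{x \<in> topspace Y. t < f x} =
          (if t < 0 then topspace Y else (\<Union>r\<in>{r\<in>?D. t < r}. topspace Y - Y closure_of G r))"
        using f_greater by force
      ultimately show "openin Y {x \<in> topspace Y. t < f x}" by simp
      have "openin Y (\<Union>r\<in>{r\<in>?D. r < t}. G r)"
        using G(1) by (intro openin_Union) auto
      moreover have "{x \<in> topspace Y. f x < t} =
          (if 1 < t then topspace Y else (\<Union>r\<in>{r\<in>?D. r < t}. G r))"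
        using f_less openin_subset[OF G(1)] by force
      ultimately show "openin Y {x \<in> topspace Y. f x < t}" by simp
    qed
    show "isotone f"
      unfolding isotone_def
    proof (intro allI impI)
      fix x y assume xy: "(x, y) \<in> ord"
      show "f x \<le> f y"
        by (rule f_ge) (use f01 f_le lowerD[OF G(2) xy] in auto)
    qed
    show "0 \<le> f x \<and> f x \<le> 1" for x by (rule f01)
    show "f x = 0" if "x \<in> S" for x
      using f_le[OF 01(1), of x] f01[of x] G0 U(5) that by force
    show "f x = 1" if "x \<in> T" for x
    proof (rule antisym)
      show "1 \<le> f x"
      proof (rule f_ge)
        fix r assume r: "r \<in> ?D" "x \<in> G r"
        have "x \<notin> G 1" using G1 that by blast
        then show "1 \<le> r" using Gsub(2)[OF r(1) 01(2)] r by (cases "r < 1") auto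
      qed simp
    qed (use f01 in simp)
  qed
qed

definition strictly_isotone :: "('a \<Rightarrow> real) \<Rightarrow> bool"
  where "strictly_isotone f \<longleftrightarrow> (\<forall>x y. (x, y) \<in> ord \<longrightarrow> x \<noteq> y \<longrightarrow> f x < f y)"

text \<open>Apply the Urysohn lemma to the down-set of \<open>x\<close> and the up-set of
  \<open>y\<close>: a common point would give \<open>(y, x) \<in> ord\<close>, against
  antisymmetry.\<close>

lemma separate_strict:
  assumes "(x, y) \<in> ord" "x \<noteq> y"
  obtains f where "continuous_map Y euclideanreal f" "isotone f"
    "\<And>z. 0 \<le> f z \<and> f z \<le> 1" "f x = 0" "f y = 1"
proof -
  have x: "x \<in> topspace Y" and y: "y \<in> topspace Y" using assms ord_in by auto
  have cl: "closedin Y {z}" if "z \<in> topspace Y" for z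
    using that Hausdorff by (simp add: closedin_Hausdorff_singleton)
  show thesis
  proof (rule ordered_Urysohn)
    show "closedin Y (ord\<inverse> `` {x})" "closedin Y (ord `` {y})"
      using closedin_ord_Image cl x y by blast+
    show "lower (ord\<inverse> `` {x})" "lower (topspace Y - ord `` {y})"
      unfolding lower_def using ord_in ord_trans by blast+
    show "ord\<inverse> `` {x} \<inter> ord `` {y} = {}"
      using assms ord_trans ord_antisym by blast
    fix f assume "continuous_map Y euclideanreal f" "isotone f"
      "\<And>z. 0 \<le> f z \<and> f z \<le> 1" "\<And>z. z \<in> ord\<inverse> `` {x} \<Longrightarrow> f z = 0" "\<And>z. z \<in> ord `` {y} \<Longrightarrow> f z = 1"
    then show thesis using that ord_refl x y by blast
  qed
qed

text \<open>One isotone function is taken for each pair of basic open sets that can be separated at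
  all. These countably many functions separate every strict pair, so their geometrically weighted
  sum is strictly isotone.\<close>

lemma ex_strictly_isotone:
  obtains f where "continuous_map Y euclideanreal f" "strictly_isotone f"
proof -
  obtain \<B> where \<B>: "countable \<B>" "\<And>V. V \<in> \<B> \<Longrightarrow> openin Y V"
    "\<And>U x. openin Y U \<Longrightarrow> x \<in> U \<Longrightarrow> \<exists>V\<in>\<B>. x \<in> V \<and> V \<subseteq> U"
    using second_countable unfolding second_countable_def by metis
  define good where "good f \<longleftrightarrow> continuous_map Y euclideanreal f \<and> isotone f \<and>
    (\<forall>z. 0 \<le> f z \<and> f z \<le> 1)" for f
  define sepr where "sepr p f \<longleftrightarrow> good f \<and> (\<forall>x\<in>fst p. \<forall>y\<in>snd p. f x < f y)" for p f
  \<comment> \<open>If \<open>p\<close> admits no separating function, the default is the zero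
    function, which is isotone and so does no harm in the sum.\<close>
  define F where "F p = (if \<exists>f. sepr p f then SOME f. sepr p f else (\<lambda>_. 0))" for p
  have good0: "good (\<lambda>_. 0)" by (simp add: good_def isotone_def)
  have F: "good (F p)" for p
  proof (cases "\<exists>f. sepr p f")
    case True
    then have "sepr p (F p)" unfolding F_def by (simp add: someI_ex)
    then show ?thesis by (simp add: sepr_def)
  qed (simp add: F_def good0)
  have F_sep: "F (A, B) x < F (A, B) y" if "sepr (A, B) f" "x \<in> A" "y \<in> B" for A B f x y
  proof -
    have "sepr (A, B) (F (A, B))"
      unfolding F_def using that(1) someI_ex[of "sepr (A, B)"] by auto
    then show ?thesis using that by (simp add: sepr_def)
  qed
  define g where "g n = F (from_nat_into (\<B> \<times> \<B>) n)" for n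
  have g: "continuous_map Y euclideanreal (g n)" "isotone (g n)" "0 \<le> g n z" "g n z \<le> 1" for n z
    using F unfolding g_def good_def by blast+
  define k where "k n z = (1/2) ^ n * g n z" for n z
  have k: "norm (k n z) \<le> (1/2) ^ n" for n z
    using g(3,4)[of n z] by (simp add: k_def abs_mult mult_left_le)
  have sk: "summable (\<lambda>n. k n z)" for z
    by (rule summable_comparison_test'[OF summable_geometric[of "1/2::real"]]) (use k in auto)
  have ul: "uniform_limit UNIV (\<lambda>n z. \<Sum>i<n. k i z) (\<lambda>z. \<Sum>i. k i z) sequentially"
    by (rule Weierstrass_m_test[OF k]) simp
  have "continuous_map Y Met_TC.mtopology (\<lambda>z. \<Sum>i. k i z)"
  proof (rule Met_TC.continuous_map_uniform_limit_alt)
    show "\<forall>\<^sub>F n in sequentially. continuous_map Y Met_TC.mtopology (\<lambda>z. \<Sum>i<n. k i z)"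
      using g(1) unfolding k_def by (auto intro!: always_eventually continuous_map_sum continuous_map_real_mult_left)
    show "\<And>\<epsilon>. 0 < \<epsilon> \<Longrightarrow> \<forall>\<^sub>F n in sequentially. \<forall>z\<in>topspace Y. dist (\<Sum>i<n. k i z) (\<Sum>i. k i z) < \<epsilon>"
      using ul[unfolded uniform_limit_iff] by (blast intro: eventually_mono)
  qed auto
  then have "continuous_map Y euclideanreal (\<lambda>z. \<Sum>i. k i z)" by simp
  moreover have "strictly_isotone (\<lambda>z. \<Sum>i. k i z)"
    unfolding strictly_isotone_def
  proof (intro allI impI)
    fix x y assume xy: "(x, y) \<in> ord" "x \<noteq> y"
    obtain f where f: "continuous_map Y euclideanreal f" "isotone f"
      "\<And>z. 0 \<le> f z \<and> f z \<le> 1" "f x = 0" "f y = 1"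
      using separate_strict[OF xy] by blast
    \<comment> \<open>The threshold 1/2 turns the separation of two points into a separation of two
      basic neighbourhoods.\<close>
    have "openin Y {z \<in> topspace Y. f z < 1/2}" "openin Y {z \<in> topspace Y. 1/2 < f z}"
      using f(1) unfolding continuous_map_upper_lower_semicontinuous_lt by blast+
    moreover have "x \<in> {z \<in> topspace Y. f z < 1/2}" "y \<in> {z \<in> topspace Y. 1/2 < f z}"
      using f xy ord_in by auto
    ultimately obtain A B where AB: "A \<in> \<B>" "B \<in> \<B>" "x \<in> A" "y \<in> B"
      "A \<subseteq> {z \<in> topspace Y. f z < 1/2}" "B \<subseteq> {z \<in> topspace Y. 1/2 < f z}"
      using \<B>(3) by meson
    have "sepr (A, B) f"
      unfolding sepr_def good_def using f AB by force
    then have less: "F (A, B) x < F (A, B) y" using F_sep AB by blast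
    obtain n where n: "from_nat_into (\<B> \<times> \<B>) n = (A, B)"
      using from_nat_into_surj[of "\<B> \<times> \<B>" "(A, B)"] \<B>(1) AB by auto
    have pos: "0 \<le> k i y - k i x" for i
      using g(2)[of i] xy(1) by (simp add: k_def isotone_def mult_left_mono)
    have "0 < (\<Sum>i. k i y - k i x)"
    proof (rule suminf_pos2[OF summable_diff[OF sk sk] pos])
      show "0 < k n y - k n x" using less by (simp add: k_def g_def n)
    qed
    then show "(\<Sum>i. k i x) < (\<Sum>i. k i y)"
      using suminf_diff[OF sk[of y] sk[of x]] by simp
  qed
  ultimately show thesis by (rule that)
qed

end

section \<open>Generic heights\<close>


text \<open>The Baire argument for the sup distance on a set closed under uniform limits: balls are
  nested so that each new one, within \<open>H\<close>, satisfies the next of the open dense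
  conditions.\<close>

lemma uniform_generic_existence:
  fixes X :: "'a set" and H :: "('a \<Rightarrow> real) set" and G :: "nat \<Rightarrow> ('a \<Rightarrow> real) \<Rightarrow> bool"
  assumes ne: "h0 \<in> H"
    and dense: "\<And>n h \<epsilon>. h \<in> H \<Longrightarrow> \<epsilon> > 0 \<Longrightarrow> \<exists>g\<in>H. G n g \<and> (\<forall>x\<in>X. \<bar>g x - h x\<bar> \<le> \<epsilon>)"
    and opn: "\<And>n h. h \<in> H \<Longrightarrow> G n h \<Longrightarrow> \<exists>\<delta>>0. \<forall>g\<in>H. (\<forall>x\<in>X. \<bar>g x - h x\<bar> \<le> \<delta>) \<longrightarrow> G n g"
    and closed: "\<And>f g. (\<And>n. f n \<in> H) \<Longrightarrow> uniform_limit X f g sequentially \<Longrightarrow> g \<in> H"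
  shows "\<exists>h\<in>H. \<forall>n. G n h"
proof -
  \<comment> \<open>A pair is a centre with a radius. Displacement of the centre and new radius are
    each at most half the old radius, so the new ball lies in the old one; this is the source of the
    bound \<open>\<delta> n - \<delta> m\<close> below.\<close>
  define Q where "Q n p q \<longleftrightarrow> (\<forall>x\<in>X. \<bar>fst q x - fst p x\<bar> \<le> snd p / 2) \<and> snd q \<le> snd p / 2 \<and>
    (\<forall>g\<in>H. (\<forall>x\<in>X. \<bar>g x - fst q x\<bar> \<le> snd q) \<longrightarrow> G n g)"
    for n :: nat and p q :: "('a \<Rightarrow> real) \<times> real"
  have "\<exists>q. (fst q \<in> H \<and> 0 < snd q) \<and> Q n p q" if p: "fst p \<in> H \<and> 0 < snd p" for p n
  proof -
    obtain g where g: "g \<in> H" "G n g" "\<forall>x\<in>X. \<bar>g x - fst p x\<bar> \<le> snd p / 2"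
      using dense[of "fst p" "snd p / 2" n] p by auto
    obtain \<delta> where \<delta>: "\<delta> > 0" "\<forall>k\<in>H. (\<forall>x\<in>X. \<bar>k x - g x\<bar> \<le> \<delta>) \<longrightarrow> G n k"
      using opn[OF g(1,2)] by blast
    show ?thesis
    proof (intro exI[of _ "(g, min \<delta> (snd p / 2))"] conjI)
      show "Q n p (g, min \<delta> (snd p / 2))" using g \<delta> by (simp add: Q_def)
    qed (use g \<delta> p in auto)
  qed
  then obtain s where s: "\<And>n. fst (s n) \<in> H \<and> 0 < snd (s n)" "\<And>n. Q n (s n) (s (Suc n))"
    using dependent_nat_choice[of "\<lambda>_ p. fst p \<in> H \<and> 0 < snd p" Q] ne
    by (metis fst_conv snd_conv zero_less_one)
  define f \<delta> where "f n = fst (s n)" and "\<delta> n = snd (s n)" for n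
  have fH: "f n \<in> H" and \<delta>0: "0 < \<delta> n" for n
    using s(1) by (auto simp: f_def \<delta>_def)
  have f: "x \<in> X \<Longrightarrow> \<bar>f (Suc n) x - f n x\<bar> \<le> \<delta> n / 2" and \<delta>: "\<delta> (Suc n) \<le> \<delta> n / 2"
    and Gn: "\<And>g. \<lbrakk>g \<in> H; \<And>x. x \<in> X \<Longrightarrow> \<bar>g x - f (Suc n) x\<bar> \<le> \<delta> (Suc n)\<rbrakk> \<Longrightarrow> G n g" for n x
    using s(2)[of n] by (auto simp: Q_def f_def \<delta>_def)
  have diff: "\<bar>f m x - f n x\<bar> \<le> \<delta> n - \<delta> m" if "x \<in> X" "n \<le> m" for n m x
    using that(2)
  proof (induction m rule: dec_induct)
    case (step m)
    then show ?case using f[OF that(1), of m] \<delta>[of m] by linarith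
  qed simp
  then have diff': "\<bar>f m x - f n x\<bar> \<le> \<delta> n" if "x \<in> X" "n \<le> m" for n m x
    using that \<delta>0[of m] by fastforce
  have \<delta>_le: "\<delta> n \<le> \<delta> 0 * (1/2) ^ n" for n
  proof (induction n)
    case (Suc n)
    then show ?case using \<delta>[of n] by simp
  qed simp
  have "uniformly_Cauchy_on X f"
    unfolding uniformly_Cauchy_on_def
  proof (intro allI impI)
    fix e :: real assume "e > 0"
    obtain N where N: "(1/2::real) ^ N < e / 2 / \<delta> 0"
      using real_arch_pow_inv[of "e / 2 / \<delta> 0" "1/2"] \<open>e > 0\<close> \<delta>0[of 0] by auto
    then have "\<delta> 0 * (1/2) ^ N < e / 2" using \<delta>0[of 0] by (simp add: field_simps)
    then have "\<delta> N < e / 2" using \<delta>_le[of N] by linarith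
    then have "dist (f m x) (f n x) < e" if "x \<in> X" "m \<ge> N" "n \<ge> N" for x m n
      using diff'[OF that(1,2)] diff'[OF that(1,3)] by (simp add: dist_real_def)
    then show "\<exists>M. \<forall>x\<in>X. \<forall>m\<ge>M. \<forall>n\<ge>M. dist (f m x) (f n x) < e" by blast
  qed
  then obtain h where h: "uniform_limit X f h sequentially"
    using Cauchy_uniformly_convergent uniformly_convergent_on_def by blast
  have "G n h" for n
  proof (rule Gn)
    show "h \<in> H" using closed fH h by blast
    fix x assume x: "x \<in> X"
    have "(\<lambda>m. f m x) \<longlonglongrightarrow> h x" using tendsto_uniform_limitI[OF h x] .
    then have "(\<lambda>m. \<bar>f m x - f (Suc n) x\<bar>) \<longlonglongrightarrow> \<bar>h x - f (Suc n) x\<bar>"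
      by (intro tendsto_intros)
    then show "\<bar>h x - f (Suc n) x\<bar> \<le> \<delta> (Suc n)"
      by (rule LIMSEQ_le_const2) (use diff'[OF x] in blast)
  qed
  then show ?thesis using closed fH h by blast
qed

locale fence_space = compact_ordered_space +
  assumes comparable: "\<lbrakk>x \<in> topspace Y; y \<in> topspace Y\<rbrakk> \<Longrightarrow>
    (x, y) \<in> ord \<or> (y, x) \<in> ord \<longleftrightarrow> connected_component_of Y x y"
begin

lemma ord_component: "(x, y) \<in> ord \<Longrightarrow> connected_component_of Y x y"
  using comparable ord_in by blast

lemma clopen_component:
  assumes "clopenin Y W" "connected_component_of Y x y"
  shows "x \<in> W \<longleftrightarrow> y \<in> W"
proof -
  obtain C where C: "connectedin Y C" "x \<in> C" "y \<in> C"
    using assms(2) by (auto simp: connected_component_of_def)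
  then have "C \<subseteq> W \<or> disjnt C W"
    using assms(1) connectedin_clopen_cases by (auto simp: clopenin_def)
  then show ?thesis using C by (auto simp: disjnt_iff)
qed

lemma clopen_ord: "clopenin Y W \<Longrightarrow> (x, y) \<in> ord \<Longrightarrow> x \<in> W \<longleftrightarrow> y \<in> W"
  using clopen_component ord_component by blast

text \<open>An instance of the cut-wire theorem, used below whenever a clopen set has to be fitted
  to heights or slabs.\<close>

lemma clopen_separation:
  assumes "closedin Y A" "closedin Y B"
    and "\<And>x y. x \<in> A \<Longrightarrow> y \<in> B \<Longrightarrow> connected_component_of Y x y \<Longrightarrow> False"
  obtains W where "clopenin Y W" "A \<subseteq> W" "W \<inter> B = {}"
proof -
  have "disjnt C A \<or> disjnt C B" if "connectedin Y C" for C
    using assms(3) that unfolding connected_component_of_def disjnt_iff by blast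
  then have "separated_between Y A B"
    by (rule cut_wire_fence_theorem[OF compact Hausdorff assms(1,2)])
  then obtain W where "closedin Y W" "openin Y W" "A \<subseteq> W" "B \<subseteq> topspace Y - W"
    unfolding separated_between by blast
  then show thesis using that[of W] by (auto simp: clopenin_def)
qed

text \<open>Weak inequalities here and strict ones in \<open>crossed\<close>: failing to touch and
  crossing are then both stable under small uniform changes of \<open>h\<close>.\<close>

definition touched :: "('a \<Rightarrow> real) \<Rightarrow> 'a set \<Rightarrow> real \<Rightarrow> real \<Rightarrow> bool"
  where "touched h W t t' \<longleftrightarrow> (\<exists>x\<in>W. \<exists>y\<in>W. (x, y) \<in> ord \<and> h x \<le> t \<and> t' \<le> h y)"

definition crossed :: "('a \<Rightarrow> real) \<Rightarrow> 'a set \<Rightarrow> real \<Rightarrow> real \<Rightarrow> bool"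
  where "crossed h W t t' \<longleftrightarrow> (\<exists>x\<in>W. \<exists>y\<in>W. (x, y) \<in> ord \<and> h x < t \<and> t' < h y)"

text \<open>
  The heights competing in the Baire argument: they dominate the increments of \<open>f\<close>, so that uniform
  limits of them stay strictly increasing when \<open>f\<close> is.
\<close>

definition steep :: "('a \<Rightarrow> real) \<Rightarrow> ('a \<Rightarrow> real) set"
  where "steep f = {h. continuous_map Y euclideanreal h \<and> (\<forall>x y. (x, y) \<in> ord \<longrightarrow> f y - f x \<le> h y - h x)}"

lemma openin_less: "continuous_map Y euclideanreal h \<Longrightarrow> openin Y {x \<in> topspace Y. h x < t}"
  and openin_greater: "continuous_map Y euclideanreal h \<Longrightarrow> openin Y {x \<in> topspace Y. t < h x}"
  by (simp_all add: continuous_map_upper_lower_semicontinuous_lt)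

lemma closedin_le: "continuous_map Y euclideanreal h \<Longrightarrow> closedin Y {x \<in> topspace Y. h x \<le> t}"
  and closedin_ge: "continuous_map Y euclideanreal h \<Longrightarrow> closedin Y {x \<in> topspace Y. t \<le> h x}"
  by (simp_all add: continuous_map_upper_lower_semicontinuous_le)

lemma steep_uniform_limit:
  assumes "\<And>n. g n \<in> steep f" "uniform_limit (topspace Y) g h sequentially"
  shows "h \<in> steep f"
  unfolding steep_def mem_Collect_eq
proof (intro conjI allI impI)
  have "continuous_map Y Met_TC.mtopology h"
  proof (rule Met_TC.continuous_map_uniform_limit_alt)
    show "\<forall>\<^sub>F n in sequentially. continuous_map Y Met_TC.mtopology (g n)"
      using assms(1) by (simp add: steep_def)
    show "\<And>\<epsilon>. 0 < \<epsilon> \<Longrightarrow> \<forall>\<^sub>F n in sequentially. \<forall>z\<in>topspace Y. dist (g n z) (h z) < \<epsilon>"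
      using assms(2) unfolding uniform_limit_iff by blast
  qed auto
  then show "continuous_map Y euclideanreal h" by simp
  fix x y assume xy: "(x, y) \<in> ord"
  have "(\<lambda>n. g n y - g n x) \<longlonglongrightarrow> h y - h x"
    using xy ord_in by (intro tendsto_diff tendsto_uniform_limitI[OF assms(2)]) auto
  moreover have "\<And>n. f y - f x \<le> g n y - g n x" using assms(1) xy by (simp add: steep_def)
  ultimately show "f y - f x \<le> h y - h x" using LIMSEQ_le_const by blast
qed

lemma bounded_continuous:
  assumes "continuous_map Y euclideanreal h"
  obtains B where "B > 0" "\<And>x. x \<in> topspace Y \<Longrightarrow> \<bar>h x\<bar> \<le> B"
proof -
  have "compact (h ` topspace Y)"
    using image_compactin[OF _ assms] compact by (auto simp: compact_space_def)
  then have "bounded (h ` topspace Y)" by (rule compact_imp_bounded)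
  then obtain B where "B > 0" "\<And>y. y \<in> h ` topspace Y \<Longrightarrow> norm y \<le> B"
    unfolding bounded_pos by blast
  then show thesis using that by auto
qed

text \<open>On the compact set of related pairs in \<open>W\<close> the function \<open>m\<close> is
  positive, hence bounded below by some positive number, and half of it is a safe tolerance.\<close>

lemma not_touched_open:
  assumes W: "clopenin Y W" and h: "continuous_map Y euclideanreal h" and nt: "\<not> touched h W t t'"
  shows "\<exists>\<delta>>0. \<forall>g. (\<forall>x\<in>topspace Y. \<bar>g x - h x\<bar> \<le> \<delta>) \<longrightarrow> \<not> touched g W t t'"
proof -
  define m where "m p = max (h (fst p) - t) (t' - h (snd p))" for p
  let ?K = "ord \<inter> W \<times> W"
  have "continuous_map (prod_topology Y Y) euclideanreal m"
    unfolding m_def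
    using continuous_map_compose[OF continuous_map_fst h] continuous_map_compose[OF continuous_map_snd h]
    by (intro continuous_map_real_max continuous_map_diff) (auto simp: o_def)
  moreover have "closedin (prod_topology Y Y) ?K"
    using ord_closed W by (simp add: closedin_Int closedin_prod_Times_iff clopenin_def)
  then have "compactin (prod_topology Y Y) ?K"
    using compact by (simp add: closedin_compact_space compact_space_prod_topology)
  ultimately have "compact (m ` ?K)"
    using image_compactin by fastforce
  have pos: "m p > 0" if "p \<in> ?K" for p
    using that nt unfolding m_def touched_def by (cases p) (force simp: not_le)
  obtain \<delta> where \<delta>: "\<delta> > 0" "\<And>p. p \<in> ?K \<Longrightarrow> \<delta> \<le> m p"
  proof (cases "?K = {}")
    case True
    then show thesis by (intro that[of 1]) auto
  next
    case False
    then obtain p where "p \<in> ?K" "\<And>q. q \<in> ?K \<Longrightarrow> m p \<le> m q"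
      using compact_attains_inf[OF \<open>compact (m ` ?K)\<close>] by auto
    then show thesis using pos that by blast
  qed
  show ?thesis
  proof (intro exI[of _ "\<delta> / 2"] conjI allI impI notI)
    fix g assume g: "\<forall>x\<in>topspace Y. \<bar>g x - h x\<bar> \<le> \<delta> / 2" and "touched g W t t'"
    then obtain x y where xy: "x \<in> W" "y \<in> W" "(x, y) \<in> ord" "g x \<le> t" "t' \<le> g y"
      unfolding touched_def by blast
    then have "\<bar>g x - h x\<bar> \<le> \<delta> / 2" "\<bar>g y - h y\<bar> \<le> \<delta> / 2" using g ord_in by blast+
    moreover have "\<delta> \<le> h x - t \<or> \<delta> \<le> t' - h y"
      using \<delta>(2)[of "(x, y)"] xy by (auto simp: m_def)
    ultimately show False using xy \<delta>(1) by linarith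
  qed (use \<delta> in simp)
qed

lemma crossed_open:
  assumes "crossed h W t t'"
  shows "\<exists>\<delta>>0. \<forall>g. (\<forall>x\<in>topspace Y. \<bar>g x - h x\<bar> \<le> \<delta>) \<longrightarrow> crossed g W t t'"
proof -
  obtain x y where xy: "x \<in> W" "y \<in> W" "(x, y) \<in> ord" "h x < t" "t' < h y"
    using assms unfolding crossed_def by blast
  define \<delta> where "\<delta> = min (t - h x) (h y - t') / 2"
  have \<delta>: "0 < \<delta>" "h x + \<delta> < t" "t' < h y - \<delta>"
    using xy(4,5) by (auto simp: \<delta>_def min_def field_simps)
  show ?thesis
  proof (intro exI[of _ \<delta>] conjI allI impI)
    fix g assume g: "\<forall>z\<in>topspace Y. \<bar>g z - h z\<bar> \<le> \<delta>"
    have "\<bar>g x - h x\<bar> \<le> \<delta>" "\<bar>g y - h y\<bar> \<le> \<delta>"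
      using g ord_in xy(3) by blast+
    then have "g x < t \<and> t' < g y" using \<delta> by linarith
    then show "crossed g W t t'" unfolding crossed_def using xy by blast
  qed (use \<delta> in simp)
qed

text \<open>If a pair of distinct points touches both levels, the height is stretched about their
  midpoint when \<open>t < t'\<close> and shifted by a constant when \<open>t = t'\<close>.
  Otherwise only trivial pairs touch, which forces \<open>t = t'\<close>; then a clopen part of
  \<open>W\<close> containing everything at or below the level is lowered, and touching disappears
  altogether.\<close>

lemma steep_perturbation:
  assumes f: "strictly_isotone f" and h: "h \<in> steep f" and \<epsilon>: "\<epsilon> > 0"
    and W: "clopenin Y W" and tt: "t \<le> t'"
  shows "\<exists>g\<in>steep f. (touched g W t t' \<longrightarrow> crossed g W t t') \<and> (\<forall>x\<in>topspace Y. \<bar>g x - h x\<bar> \<le> \<epsilon>)"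
proof -
  have hc: "continuous_map Y euclideanreal h" and hs: "\<And>x y. (x, y) \<in> ord \<Longrightarrow> f y - f x \<le> h y - h x"
    using h by (auto simp: steep_def)
  have hmono: "h x \<le> h y" if "(x, y) \<in> ord" for x y
    using hs[OF that] f that by (cases "x = y") (force simp: strictly_isotone_def)+
  have hstrict: "h x < h y" if "(x, y) \<in> ord" "x \<noteq> y" for x y
    using hs[OF that(1)] f that by (force simp: strictly_isotone_def)
  have shift: "(\<lambda>z. h z + c) \<in> steep f" for c
    unfolding steep_def using hc hs by (auto intro!: continuous_map_add)
  consider "touched h W t t' \<longrightarrow> crossed h W t t'" | x y where "x \<in> W" "y \<in> W" "(x, y) \<in> ord" "h x \<le> t" "t' \<le> h y" "x \<noteq> y"
    | "t = t'" "\<And>x y. \<lbrakk>x \<in> W; y \<in> W; (x, y) \<in> ord; h x \<le> t; t' \<le> h y\<rbrakk> \<Longrightarrow> x = y"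
  proof -
    have "t = t'" if "touched h W t t'" "\<And>x y. \<lbrakk>x \<in> W; y \<in> W; (x, y) \<in> ord; h x \<le> t; t' \<le> h y\<rbrakk> \<Longrightarrow> x = y"
      using that tt unfolding touched_def by (metis order_antisym order_trans)
    then show thesis using that by blast
  qed
  then show ?thesis
  proof cases
    case 1
    then show ?thesis using h \<epsilon> by (intro bexI[of _ h]) auto
  next
    case (2 x y)
    have lt: "h x < h y" using hstrict 2 by blast
    show ?thesis
    proof (cases "t < t'")
      case True
      obtain B where B: "B > 0" "\<And>z. z \<in> topspace Y \<Longrightarrow> \<bar>h z - (t + t') / 2\<bar> \<le> B"
        using bounded_continuous[OF continuous_map_diff[OF hc continuous_map_const[THEN iffD2]]]
        by auto
      \<comment> \<open>This factor bounds the displacement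
        \<open>\<eta> * (h z - (t + t') / 2)\<close> by \<epsilon>.\<close>
      define \<eta> where "\<eta> = \<epsilon> / B"
      have \<eta>: "\<eta> > 0" using B \<epsilon> by (simp add: \<eta>_def)
      \<comment> \<open>All increments are multiplied by \<open>1 + \<eta>\<close>, which keeps
        \<open>g\<close> steep; \<open>x\<close> and \<open>y\<close> are strictly on opposite sides
        of the midpoint and move outwards.\<close>
      define g where "g z = h z + \<eta> * (h z - (t + t') / 2)" for z
      show ?thesis
      proof (intro bexI[of _ g] conjI ballI impI)
        show "g \<in> steep f"
          unfolding steep_def mem_Collect_eq
        proof (intro conjI allI impI)
          show "continuous_map Y euclideanreal g"
            unfolding g_def using hc
            by (intro continuous_map_add continuous_map_real_mult_left continuous_map_diff) auto
          fix a b assume ab: "(a, b) \<in> ord"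
          have "g b - g a = (h b - h a) + \<eta> * (h b - h a)" by (simp add: g_def algebra_simps)
          moreover have "0 \<le> \<eta> * (h b - h a)" using hmono[OF ab] \<eta> by simp
          ultimately show "f b - f a \<le> g b - g a" using hs[OF ab] by linarith
        qed
        have "\<eta> * (h x - (t + t') / 2) < 0" "0 < \<eta> * (h y - (t + t') / 2)"
          using \<eta> 2 True by (auto intro!: mult_pos_neg mult_pos_pos)
        then have "g x < t" "t' < g y" using 2 by (auto simp: g_def)
        then show "crossed g W t t'" unfolding crossed_def using 2 by blast
        fix z assume "z \<in> topspace Y"
        then have "\<eta> * \<bar>h z - (t + t') / 2\<bar> \<le> \<eta> * B" using B(2) \<eta> by (intro mult_left_mono) auto
        moreover have "\<eta> * B = \<epsilon>" using B(1) by (simp add: \<eta>_def)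
        ultimately show "\<bar>g z - h z\<bar> \<le> \<epsilon>" using \<eta> by (simp add: g_def abs_mult)
      qed
    next
      case False
      then have t: "t' = t" using tt by simp
      \<comment> \<open>As \<open>h x < h y\<close>, at most one of the two points is at height
        \<open>t\<close>. The shift moves that point to its proper side, and half of the gap keeps
        the other one on its own.\<close>
      obtain c where c: "\<bar>c\<bar> \<le> \<epsilon>" "h x + c < t" "t < h y + c"
      proof (cases "h x < t")
        case True
        show thesis
          by (rule that[of "min \<epsilon> ((t - h x) / 2)"]) (use True 2 \<epsilon> t in \<open>auto simp: min_def field_simps\<close>)
      next
        case False
        then show thesis
          by (intro that[of "- min \<epsilon> ((h y - t) / 2)"]) (use 2 \<epsilon> t lt in \<open>auto simp: min_def field_simps\<close>)
      qed
      then have "crossed (\<lambda>z. h z + c) W t t'" unfolding crossed_def using 2 t by blast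
      then show ?thesis using shift c(1) by (intro bexI[of _ "\<lambda>z. h z + c"]) auto
    qed
  next
    case 3
    \<comment> \<open>The set \<open>E\<close> will contain the points of \<open>W\<close> at or
      below \<open>t\<close>, but none at or above \<open>t + \<epsilon>\<close>. Lowering it by
      \<epsilon> puts \<open>E\<close> below \<open>t\<close> while the rest of \<open>W\<close>
      stays above, and no component meets both parts.\<close>
    let ?S = "W \<inter> {x \<in> topspace Y. h x \<le> t}"
    let ?T = "(W \<inter> {x \<in> topspace Y. t + \<epsilon> \<le> h x}) \<union> (topspace Y - W)"
    have "closedin Y ?S" "closedin Y ?T"
      using W closedin_le[OF hc] closedin_ge[OF hc] by (auto simp: clopenin_def)
    moreover have False if x: "x \<in> ?S" and y: "y \<in> ?T" and xy: "connected_component_of Y x y" for x y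
    proof -
      have "y \<in> W" using clopen_component[OF W xy] x by blast
      then have hy: "y \<in> topspace Y" "t + \<epsilon> \<le> h y" using y by auto
      have "(x, y) \<in> ord \<or> (y, x) \<in> ord" using comparable x hy(1) xy by blast
      then have "(x, y) \<in> ord" using hmono x hy \<epsilon> by force
      then have "x = y" using 3 x \<open>y \<in> W\<close> hy \<epsilon> by auto
      then show False using hy x \<epsilon> by auto
    qed
    ultimately obtain E where Ec: "clopenin Y E" and E: "?S \<subseteq> E" "E \<inter> ?T = {}"
      by (rule clopen_separation)
    then have Eoc: "openin Y E" "closedin Y E" by (auto simp: clopenin_def)
    define g where "g z = (if z \<in> E then h z - \<epsilon> else h z)" for z
    show ?thesis
    proof (intro bexI[of _ g] conjI ballI impI)
      show "g \<in> steep f"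
        unfolding steep_def mem_Collect_eq
      proof (intro conjI allI impI)
        show "continuous_map Y euclideanreal g"
          unfolding continuous_map_upper_lower_semicontinuous_lt
        proof (intro allI conjI)
          fix a
          have "{z \<in> topspace Y. a < g z} = (E \<inter> {z \<in> topspace Y. a + \<epsilon> < h z}) \<union> ((topspace Y - E) \<inter> {z \<in> topspace Y. a < h z})"
            using clopenin_subset[OF Ec] by (auto simp: g_def)
          then show "openin Y {z \<in> topspace Y. a < g z}"
            using Eoc openin_greater[OF hc] by auto
          have "{z \<in> topspace Y. g z < a} = (E \<inter> {z \<in> topspace Y. h z < a + \<epsilon>}) \<union> ((topspace Y - E) \<inter> {z \<in> topspace Y. h z < a})"
            using clopenin_subset[OF Ec] by (auto simp: g_def)
          then show "openin Y {z \<in> topspace Y. g z < a}"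
            using Eoc openin_less[OF hc] by auto
        qed
        fix a b assume "(a, b) \<in> ord"
        then show "f b - f a \<le> g b - g a"
          using clopen_ord[OF Ec] hs by (auto simp: g_def)
      qed
      show "crossed g W t t'" if g: "touched g W t t'"
      proof -
        obtain x y where xy: "x \<in> W" "y \<in> W" "(x, y) \<in> ord" "g x \<le> t" "t' \<le> g y"
          using g unfolding touched_def by blast
        have T: "x \<in> topspace Y" "y \<in> topspace Y" using xy(3) by (rule ord_in)+
        have "x \<in> E"
        proof (rule ccontr)
          assume "x \<notin> E"
          then have "x \<in> ?S" using xy T by (simp add: g_def)
          then show False using E(1) \<open>x \<notin> E\<close> by blast
        qed
        then have "y \<in> E" using clopen_ord[OF Ec xy(3)] by simp
        then have "y \<in> ?T" using xy T 3(1) by (simp add: g_def)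
        then have False using E(2) \<open>y \<in> E\<close> by blast
        then show ?thesis ..
      qed
    qed (use \<epsilon> in \<open>simp add: g_def\<close>)
  qed
qed

lemma ex_generic_height:
  obtains h where "continuous_map Y euclideanreal h" "strictly_isotone h"
    "\<And>W t t'. \<lbrakk>clopenin Y W; t \<in> \<rat>; t' \<in> \<rat>; t \<le> t'; touched h W t t'\<rbrakk> \<Longrightarrow> crossed h W t t'"
proof -
  obtain f where f: "continuous_map Y euclideanreal f" "strictly_isotone f"
    using ex_strictly_isotone .
  define D where "D = {(W, t, t'). clopenin Y W \<and> t \<in> \<rat> \<and> t' \<in> \<rat> \<and> t \<le> (t'::real)}"
  define e where "e = from_nat_into D"
  have "D \<subseteq> {W. clopenin Y W} \<times> \<rat> \<times> \<rat>" by (auto simp: D_def)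
  moreover have "countable ({W. clopenin Y W} \<times> (\<rat>::real set) \<times> (\<rat>::real set))"
    using countable_clopenin[OF compact second_countable] countable_rat by blast
  ultimately have "countable D" by (rule countable_subset)
  moreover have "(topspace Y, 0, 0) \<in> D" by (simp add: D_def clopenin_topspace)
  ultimately have e: "range e = D" unfolding e_def by (intro range_from_nat_into) auto
  define G where "G n h = (case e n of (W, t, t') \<Rightarrow> touched h W t t' \<longrightarrow> crossed h W t t')" for n h
  have "\<exists>h\<in>steep f. \<forall>n. G n h"
  proof (rule uniform_generic_existence)
    show "f \<in> steep f" using f by (simp add: steep_def)
    fix n h assume h: "h \<in> steep f"
    obtain W t t' where en: "e n = (W, t, t')" by (cases "e n")
    then have "(W, t, t') \<in> D" using e by (metis rangeI)
    then have W: "clopenin Y W" "t \<le> t'" by (auto simp: D_def)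
    show "\<exists>g\<in>steep f. G n g \<and> (\<forall>x\<in>topspace Y. \<bar>g x - h x\<bar> \<le> \<epsilon>)" if "\<epsilon> > 0" for \<epsilon>
      using steep_perturbation[OF f(2) h that W] by (simp add: G_def en)
    assume "G n h"
    then consider "\<not> touched h W t t'" | "crossed h W t t'" by (auto simp: G_def en)
    then show "\<exists>\<delta>>0. \<forall>g\<in>steep f. (\<forall>x\<in>topspace Y. \<bar>g x - h x\<bar> \<le> \<delta>) \<longrightarrow> G n g"
    proof cases
      case 1
      have "continuous_map Y euclideanreal h" using h by (simp add: steep_def)
      from not_touched_open[OF W(1) this 1] show ?thesis by (auto simp: G_def en)
    next
      case 2
      from crossed_open[OF 2] show ?thesis by (auto simp: G_def en)
    qed
  next
    fix g h assume "\<And>n. g n \<in> steep f" "uniform_limit (topspace Y) g h sequentially"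
    then show "h \<in> steep f" by (rule steep_uniform_limit)
  qed
  then obtain h where h: "h \<in> steep f" and G: "\<And>n. G n h" by blast
  show thesis
  proof
    show "continuous_map Y euclideanreal h" using h by (simp add: steep_def)
    show "strictly_isotone h"
      using h f(2) by (fastforce simp: steep_def strictly_isotone_def)
    fix W t t' assume "clopenin Y W" "t \<in> \<rat>" "t' \<in> \<rat>" "t \<le> t'" and tch: "touched h W t t'"
    then have "(W, t, t') \<in> range e" unfolding e by (simp add: D_def)
    then obtain n where "e n = (W, t, t')" by (metis rangeE)
    then show "crossed h W t t'" using G[of n] tch by (simp add: G_def)
  qed
qed

end

section \<open>Slabs and dominated clopen partitions\<close>


definition chain_struct :: "('b \<times> int) set \<Rightarrow> ('b \<times> int \<Rightarrow> 'i) \<Rightarrow> 'b \<Rightarrow> 'i lr_struct"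
  where "chain_struct X e W = \<lparr>lr_top = discrete_topology {e (W, i) |i. (W, i) \<in> X},
    lr_R = {(e (W, i), e (W, j)) |i j. (W, i) \<in> X \<and> (W, j) \<in> X \<and> \<bar>i - j\<bar> \<le> 1},
    lr_le = {(e (W, i), e (W, j)) |i j. (W, i) \<in> X \<and> (W, j) \<in> X \<and> i \<le> j}\<rparr>"

text \<open>By convexity an integer strictly between \<open>i\<close> and \<open>j\<close> is the
  index of an intermediate element, so immediate successors are exactly the next indices.\<close>

lemma finite_HLO_chain_struct:
  assumes fin: "finite X" and inj: "inj_on e X"
    and convex: "\<And>i j k. \<lbrakk>(W, i) \<in> X; (W, j) \<in> X; i < k; k < j\<rbrakk> \<Longrightarrow> (W, k) \<in> X"
  shows "finite_HLO (chain_struct X e W)"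
proof -
  let ?A = "{e (W, i) |i. (W, i) \<in> X}"
  let ?r = "{(e (W, i), e (W, j)) |i j. (W, i) \<in> X \<and> (W, j) \<in> X \<and> i \<le> j}"
  have e: "e (W, i) = e (W, j) \<longleftrightarrow> i = j" if "(W, i) \<in> X" "(W, j) \<in> X" for i j
    using inj_on_eq_iff[OF inj that] by simp
  have r: "(e (W, i), e (W, j)) \<in> ?r \<longleftrightarrow> i \<le> j" if "(W, i) \<in> X" "(W, j) \<in> X" for i j
    using that e by auto
  have "?A \<subseteq> e ` X" by auto
  then have finA: "finite ?A" using fin finite_subset by blast
  have lin: "linear_order_on ?A ?r"
    unfolding linear_order_on_def partial_order_on_def preorder_on_def
  proof (intro conjI)
    show "refl_on ?A ?r" by (auto simp: refl_on_def)
    show "trans ?r"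
    proof (rule transI)
      fix x y z assume "(x, y) \<in> ?r" "(y, z) \<in> ?r"
      then obtain i j j' k where *: "x = e (W, i)" "y = e (W, j)" "y = e (W, j')" "z = e (W, k)"
        "(W, i) \<in> X" "(W, j) \<in> X" "(W, j') \<in> X" "(W, k) \<in> X" "i \<le> j" "j' \<le> k" by blast
      then have "j = j'" using e by metis
      then show "(x, z) \<in> ?r" using * r by simp
    qed
    show "antisym ?r"
    proof (rule antisymI)
      fix x y assume "(x, y) \<in> ?r" "(y, x) \<in> ?r"
      then obtain i j i' j' where *: "x = e (W, i)" "y = e (W, j)" "y = e (W, j')" "x = e (W, i')"
        "(W, i) \<in> X" "(W, j) \<in> X" "(W, j') \<in> X" "(W, i') \<in> X" "i \<le> j" "j' \<le> i'" by blast
      then have "j = j'" "i = i'" using e by metis+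
      then show "x = y" using * by simp
    qed
    show "total_on ?A ?r"
      unfolding total_on_def
    proof (intro ballI impI)
      fix x y assume "x \<in> ?A" "y \<in> ?A"
      then obtain i j where *: "x = e (W, i)" "y = e (W, j)" "(W, i) \<in> X" "(W, j) \<in> X" by blast
      show "(x, y) \<in> ?r \<or> (y, x) \<in> ?r"
        unfolding *(1,2) r[OF *(3,4)] r[OF *(4,3)] by linarith
    qed
    show "?r \<subseteq> ?A \<times> ?A" by auto
  qed
  have succ: "immediate_succ ?r (e (W, i)) (e (W, j)) \<longleftrightarrow> j = i + 1"
    if i: "(W, i) \<in> X" and j: "(W, j) \<in> X" for i j
  proof
    assume s: "immediate_succ ?r (e (W, i)) (e (W, j))"
    then have ij: "i < j"
      using r[OF i j] e[OF i j] by (auto simp: immediate_succ_def)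
    show "j = i + 1"
    proof (rule ccontr)
      assume "j \<noteq> i + 1"
      then have lt: "i < i + 1" "i + 1 < j" using ij by auto
      then have k: "(W, i + 1) \<in> X" using convex[OF i j] by blast
      have "e (W, i + 1) \<noteq> e (W, i)" "e (W, i + 1) \<noteq> e (W, j)"
        "(e (W, i), e (W, i + 1)) \<in> ?r" "(e (W, i + 1), e (W, j)) \<in> ?r"
        using e[OF k i] e[OF k j] r[OF i k] r[OF k j] lt by auto
      then show False using s unfolding immediate_succ_def by blast
    qed
  next
    assume ji: "j = i + 1"
    have "\<not> (\<exists>c. c \<noteq> e (W, i) \<and> c \<noteq> e (W, j) \<and> (e (W, i), c) \<in> ?r \<and> (c, e (W, j)) \<in> ?r)"
    proof
      assume "\<exists>c. c \<noteq> e (W, i) \<and> c \<noteq> e (W, j) \<and> (e (W, i), c) \<in> ?r \<and> (c, e (W, j)) \<in> ?r"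
      then obtain c where c: "c \<noteq> e (W, i)" "c \<noteq> e (W, j)" "(e (W, i), c) \<in> ?r" "(c, e (W, j)) \<in> ?r"
        by blast
      then obtain k where k: "c = e (W, k)" "(W, k) \<in> X" by blast
      then have "i \<le> k" "k \<le> j" "k \<noteq> i" "k \<noteq> j" using c r i j by auto
      then show False using ji by simp
    qed
    then show "immediate_succ ?r (e (W, i)) (e (W, j))"
      unfolding immediate_succ_def using r[OF i j] e[OF i j] ji by auto
  qed
  have "{(e (W, i), e (W, j)) |i j. (W, i) \<in> X \<and> (W, j) \<in> X \<and> \<bar>i - j\<bar> \<le> 1} =
    {(a, b). a \<in> ?A \<and> b \<in> ?A \<and> (a = b \<or> immediate_succ ?r a b \<or> immediate_succ ?r b a)}"
    (is "?L = ?R")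
  proof (intro equalityI subsetI)
    fix p assume "p \<in> ?L"
    then obtain i j where ij: "p = (e (W, i), e (W, j))" "(W, i) \<in> X" "(W, j) \<in> X" "\<bar>i - j\<bar> \<le> 1"
      by blast
    then have "i = j \<or> j = i + 1 \<or> i = j + 1" by linarith
    then show "p \<in> ?R" using ij succ by auto
  next
    fix p assume "p \<in> ?R"
    then obtain i j where ij: "p = (e (W, i), e (W, j))" "(W, i) \<in> X" "(W, j) \<in> X"
      "e (W, i) = e (W, j) \<or> immediate_succ ?r (e (W, i)) (e (W, j)) \<or> immediate_succ ?r (e (W, j)) (e (W, i))"
      by blast
    then have "i = j \<or> j = i + 1 \<or> i = j + 1" using e succ by simp
    then have "\<bar>i - j\<bar> \<le> 1" by linarith
    then show "p \<in> ?L" using ij by blast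
  qed
  then show ?thesis
    unfolding finite_HLO_def chain_struct_def using finA lin by simp
qed

lemma F0_chains:
  fixes X :: "('b \<times> int) set"
  assumes fin: "finite X" and inj: "inj_on e X"
    and convex: "\<And>W i j k. \<lbrakk>(W, i) \<in> X; (W, j) \<in> X; i < k; k < j\<rbrakk> \<Longrightarrow> (W, k) \<in> X"
    and top: "lr_top A = discrete_topology (e ` X)"
    and R: "lr_R A = {(e (W, i), e (W, j)) |W i j. (W, i) \<in> X \<and> (W, j) \<in> X \<and> \<bar>i - j\<bar> \<le> 1}"
    and le: "lr_le A = {(e (W, i), e (W, j)) |W i j. (W, i) \<in> X \<and> (W, j) \<in> X \<and> i \<le> j}"
  shows "A \<in> F0"
  unfolding F0_def mem_Collect_eq
proof (intro exI[of _ "chain_struct X e ` fst ` X"] conjI)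
  show "finite (chain_struct X e ` fst ` X)" using fin by simp
  show "\<forall>H\<in>chain_struct X e ` fst ` X. finite_HLO H"
  proof
    fix H assume "H \<in> chain_struct X e ` fst ` X"
    then obtain W where "H = chain_struct X e W" by blast
    then show "finite_HLO H" using finite_HLO_chain_struct[OF fin inj] convex by metis
  qed
  show "pairwise (\<lambda>H H'. disjnt (lr_carrier H) (lr_carrier H')) (chain_struct X e ` fst ` X)"
  proof (rule pairwise_imageI)
    fix V W :: 'b assume "V \<noteq> W"
    have "e (V, i) \<noteq> e (W, j)" if "(V, i) \<in> X" "(W, j) \<in> X" for i j
      using inj_on_eq_iff[OF inj that] \<open>V \<noteq> W\<close> by simp
    then show "disjnt (lr_carrier (chain_struct X e V)) (lr_carrier (chain_struct X e W))"
      by (simp add: chain_struct_def disjnt_iff) metis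
  qed
  have "e ` X = (\<Union>H\<in>chain_struct X e ` fst ` X. lr_carrier H)"
    by (force simp: chain_struct_def)
  then show "lr_top A = discrete_topology (\<Union>H\<in>chain_struct X e ` fst ` X. lr_carrier H)"
    by (simp add: top)
  show "lr_R A = \<Union> (lr_R ` chain_struct X e ` fst ` X)"
    unfolding R by (force simp: chain_struct_def)
  show "lr_le A = \<Union> (lr_le ` chain_struct X e ` fst ` X)"
    unfolding le by (force simp: chain_struct_def)
qed

locale height_space = fence_space +
  fixes h :: "'a \<Rightarrow> real"
  assumes continuous_h: "continuous_map Y euclideanreal h"
    and strict_h: "strictly_isotone h"
    and generic_h: "\<lbrakk>clopenin Y W; t \<in> \<rat>; t' \<in> \<rat>; t \<le> t'; touched h W t t'\<rbrakk> \<Longrightarrow> crossed h W t t'"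
begin

text \<open>The order is total on a component and \<open>h\<close> is strictly increasing along it,
  so \<open>h\<close> decides the direction.\<close>

lemma ord_iff:
  assumes "x \<in> topspace Y" "y \<in> topspace Y"
  shows "(x, y) \<in> ord \<longleftrightarrow> connected_component_of Y x y \<and> h x \<le> h y"
  using comparable[OF assms] strict_h assms ord_refl
  unfolding strictly_isotone_def by (metis less_eq_real_def not_le)

lemma intermediate_value:
  assumes xy: "connected_component_of Y x y" and c: "h x \<le> c" "c \<le> h y"
  obtains w where "connected_component_of Y x w" "h w = c"
proof -
  obtain C where C: "connectedin Y C" "x \<in> C" "y \<in> C"
    using xy by (auto simp: connected_component_of_def)
  then have "connected (h ` C)"
    using connectedin_continuous_map_image[OF continuous_h] by simp
  then have "c \<in> h ` C"
    using C c connectedD_interval[of "h ` C" "h x" "h y" c] by blast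
  then obtain w where "w \<in> C" "h w = c" by blast
  then show thesis using that C by (auto simp: connected_component_of_def)
qed

text \<open>A clopen \<open>W\<close> around \<open>z\<close> is found whose points of height within
  \<delta> of \<open>h z\<close> are all in \<open>U\<close>. The pair of \<open>z\<close> with
  itself touches the level, so by genericity some component inside \<open>W\<close>, not necessarily
  that of \<open>z\<close>, passes strictly from below to above; its points close to the level are
  in \<open>U\<close>.\<close>

lemma near_rational_level:
  assumes z: "z \<in> topspace Y" and q: "h z \<in> \<rat>" and U: "openin Y U" "z \<in> U"
  shows "\<exists>w\<in>U. h w < h z" "\<exists>w\<in>U. h z < h w"
proof -
  let ?C = "connected_component_of_set Y z"
  have C: "w \<in> topspace Y \<and> ((z, w) \<in> ord \<or> (w, z) \<in> ord)" if "w \<in> ?C" for w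
    using that comparable[OF z] connected_component_in_topspace by fastforce
  have "closedin Y (?C - U)"
    by (intro closedin_diff closedin_connected_component_of U(1))
  then have "compactin Y (?C - U)"
    using compact by (rule closedin_compact_space[rotated])
  moreover have "continuous_map Y euclideanreal (\<lambda>w. \<bar>h w - h z\<bar>)"
    using continuous_h by (intro continuous_map_real_abs continuous_map_diff) auto
  ultimately have "compact ((\<lambda>w. \<bar>h w - h z\<bar>) ` (?C - U))"
    using image_compactin by fastforce
  have pos: "0 < \<bar>h w - h z\<bar>" if "w \<in> ?C - U" for w
  proof -
    have "w \<noteq> z" using that U by blast
    then have "h w \<noteq> h z" using C[of w] that strict_h unfolding strictly_isotone_def by fastforce
    then show ?thesis by simp
  qed
  \<comment> \<open>The height is injective on the component of \<open>z\<close>, so by compactness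
    the part of this component outside \<open>U\<close> keeps a positive distance from the
    level.\<close>
  obtain \<delta> where \<delta>: "\<delta> > 0" "\<And>w. w \<in> ?C - U \<Longrightarrow> \<delta> < \<bar>h w - h z\<bar>"
  proof (cases "?C - U = {}")
    case True
    show thesis by (rule that[of 1]) (use True in auto)
  next
    case False
    then obtain w where w: "w \<in> ?C - U" "\<And>v. v \<in> ?C - U \<Longrightarrow> \<bar>h w - h z\<bar> \<le> \<bar>h v - h z\<bar>"
      using compact_attains_inf[OF \<open>compact ((\<lambda>w. \<bar>h w - h z\<bar>) ` (?C - U))\<close>] by auto
    have "\<bar>h w - h z\<bar> / 2 < \<bar>h v - h z\<bar>" if "v \<in> ?C - U" for v
      by (rule less_le_trans[OF _ w(2)[OF that]]) (use pos[OF w(1)] in simp)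
    then show thesis using that[of "\<bar>h w - h z\<bar> / 2"] pos[OF w(1)] by simp
  qed
  let ?T = "(topspace Y - U) \<inter> ({w \<in> topspace Y. h w \<le> h z + \<delta>} \<inter> {w \<in> topspace Y. h z - \<delta> \<le> h w})"
  have "closedin Y {z}" using z Hausdorff by (simp add: closedin_Hausdorff_singleton)
  moreover have "closedin Y ?T"
    using U closedin_le[OF continuous_h] closedin_ge[OF continuous_h] by blast
  moreover have False if "x \<in> {z}" "w \<in> ?T" "connected_component_of Y x w" for x w
    using that \<delta>(2)[of w] by auto
  ultimately obtain W where Wc: "clopenin Y W" and W: "{z} \<subseteq> W" "W \<inter> ?T = {}"
    by (rule clopen_separation)
  have "touched h W (h z) (h z)"
    unfolding touched_def using W(1) ord_refl z by blast
  then obtain x y where xy: "x \<in> W" "y \<in> W" "(x, y) \<in> ord" "h x < h z" "h z < h y"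
    using generic_h[OF Wc q q] unfolding crossed_def by blast
  have near: "w \<in> U" if "connected_component_of Y x w" "\<bar>h w - h z\<bar> \<le> \<delta>" for w
  proof -
    have "w \<in> W" using clopen_component[OF Wc that(1)] xy(1) by simp
    moreover from this have "w \<in> topspace Y" using clopenin_subset[OF Wc] by blast
    ultimately show ?thesis using W(2) that(2) by auto
  qed
  have c: "connected_component_of Y x y" using ord_component xy by blast
  obtain w where "connected_component_of Y x w" "h w = max (h z - \<delta>) (h x)"
    using intermediate_value[OF c, of "max (h z - \<delta>) (h x)"] xy \<delta>(1) by auto
  then show "\<exists>w\<in>U. h w < h z" using near[of w] xy \<delta>(1) by (intro bexI[of _ w]) auto
  obtain w where "connected_component_of Y x w" "h w = min (h z + \<delta>) (h y)"
    using intermediate_value[OF c, of "min (h z + \<delta>) (h y)"] xy \<delta>(1) by auto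
  then show "\<exists>w\<in>U. h z < h w" using near[of w] xy \<delta>(1) by (intro bexI[of _ w]) auto
qed

section \<open>Slabs between consecutive dyadic levels\<close>

definition level :: "nat \<Rightarrow> 'a \<Rightarrow> real"
  where "level n z = 2 ^ n * h z"

definition slab :: "nat \<Rightarrow> int \<Rightarrow> 'a set"
  where "slab n j = {z \<in> topspace Y. j \<le> level n z \<and> level n z \<le> j + 1}"

definition open_slab :: "nat \<Rightarrow> int \<Rightarrow> 'a set"
  where "open_slab n j = {z \<in> topspace Y. j < level n z \<and> level n z < j + 1}"

lemma level_Suc: "level (Suc n) z = 2 * level n z"
  by (simp add: level_def)

lemma continuous_level: "continuous_map Y euclideanreal (level n)"
  unfolding level_def using continuous_h by (rule continuous_map_real_mult_left)

lemma level_le_iff: "level n x \<le> level n y \<longleftrightarrow> h x \<le> h y"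
  by (simp add: level_def)

lemma closedin_slab: "closedin Y (slab n j)"
proof -
  have "slab n j = {z \<in> topspace Y. j \<le> level n z} \<inter> {z \<in> topspace Y. level n z \<le> j + 1}"
    by (auto simp: slab_def)
  then show ?thesis using closedin_ge[OF continuous_level] closedin_le[OF continuous_level] by auto
qed

lemma openin_open_slab: "openin Y (open_slab n j)"
proof -
  have "open_slab n j = {z \<in> topspace Y. j < level n z} \<inter> {z \<in> topspace Y. level n z < j + 1}"
    by (auto simp: open_slab_def)
  then show ?thesis using openin_greater[OF continuous_level] openin_less[OF continuous_level] by auto
qed

lemma near_integer_level:
  assumes "z \<in> topspace Y" "level n z = of_int j" "openin Y U" "z \<in> U"
  shows "\<exists>w\<in>U. level n w < level n z" "\<exists>w\<in>U. level n z < level n w"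
proof -
  have "h z = of_int j / 2 ^ n" using assms(2) by (simp add: level_def field_simps)
  then have "h z \<in> \<rat>" by simp
  from near_rational_level[OF assms(1) this assms(3,4)]
  show "\<exists>w\<in>U. level n w < level n z" "\<exists>w\<in>U. level n z < level n w"
    by (simp_all add: level_def)
qed

text \<open>By genericity every neighbourhood of a point at an integer level reaches beyond that
  level on both sides.\<close>

lemma interior_slab:
  assumes W: "clopenin Y W"
  shows "Y interior_of (W \<inter> slab n j) = W \<inter> open_slab n j"
proof (rule interior_of_unique)
  show "W \<inter> open_slab n j \<subseteq> W \<inter> slab n j" by (auto simp: slab_def open_slab_def)
  show "openin Y (W \<inter> open_slab n j)" using W openin_open_slab by (auto simp: clopenin_def)
  fix U assume U: "U \<subseteq> W \<inter> slab n j" "openin Y U"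
  show "U \<subseteq> W \<inter> open_slab n j"
  proof
    fix z assume z: "z \<in> U"
    then have zY: "z \<in> topspace Y" using U by (auto simp: slab_def)
    have sub: "of_int j \<le> level n w" "level n w \<le> of_int j + 1" if "w \<in> U" for w
      using U that by (auto simp: slab_def)
    have "level n z \<noteq> of_int j"
      using near_integer_level(1)[of z n j U] U z zY sub(1) by fastforce
    moreover have "level n z \<noteq> of_int (j + 1)"
      using near_integer_level(2)[of z n "j + 1" U] U z zY sub(2) by fastforce
    ultimately have "of_int j < level n z \<and> level n z < of_int j + 1"
      using sub[OF z] by simp
    then show "z \<in> W \<inter> open_slab n j" using U z zY by (auto simp: open_slab_def)
  qed
qed

text \<open>The same fact used inwards: points of the lower face are approached from above, points
  of the upper face from below.\<close>

lemma closure_open_slab: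
  assumes W: "clopenin Y W"
  shows "Y closure_of (W \<inter> open_slab n j) = W \<inter> slab n j"
proof (rule closure_of_unique)
  show "W \<inter> open_slab n j \<subseteq> W \<inter> slab n j" by (auto simp: slab_def open_slab_def)
  show "closedin Y (W \<inter> slab n j)" using W closedin_slab by (auto simp: clopenin_def)
  fix K assume K: "W \<inter> open_slab n j \<subseteq> K" "closedin Y K"
  show "W \<inter> slab n j \<subseteq> K"
  proof (rule subsetI, rule ccontr)
    fix z assume z: "z \<in> W \<inter> slab n j" "z \<notin> K"
    then have zY: "z \<in> topspace Y" by (auto simp: slab_def)
    have WO: "openin Y W" using W by (simp add: clopenin_def)
    consider "level n z = of_int j" | "level n z = of_int (j + 1)" | "z \<in> open_slab n j"
      using z by (force simp: slab_def open_slab_def)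
    then show False
    proof cases
      case 1
      \<comment> \<open>The bound at the opposite face keeps the neighbouring point inside the
        slab.\<close>
      let ?U = "(W - K) \<inter> {w \<in> topspace Y. level n w < j + 1}"
      have "openin Y ?U" using K WO openin_less[OF continuous_level] by blast
      then obtain w where "w \<in> ?U" "level n z < level n w"
        using near_integer_level(2)[OF zY 1, of ?U] z zY 1 by auto
      then show False using K 1 by (auto simp: open_slab_def)
    next
      case 2
      let ?U = "(W - K) \<inter> {w \<in> topspace Y. j < level n w}"
      have "openin Y ?U" using K WO openin_greater[OF continuous_level] by blast
      then obtain w where "w \<in> ?U" "level n w < level n z"
        using near_integer_level(1)[OF zY 2, of ?U] z zY 2 by auto
      then show False using K 2 by (auto simp: open_slab_def)
    qed (use z K in blast)
  qed
qed

lemma level_point: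
  assumes xy: "(x, y) \<in> ord" "x \<in> W" and W: "clopenin Y W" and p: "level n x \<le> p" "p \<le> level n y"
  obtains w where "w \<in> W" "connected_component_of Y x w" "level n w = p"
proof -
  have "h x \<le> p / 2 ^ n" "p / 2 ^ n \<le> h y" using p by (simp_all add: level_def field_simps)
  then obtain w where w: "connected_component_of Y x w" "h w = p / 2 ^ n"
    using intermediate_value[OF ord_component[OF xy(1)]] by blast
  then show thesis using that clopen_component[OF W w(1)] xy(2) by (simp add: level_def)
qed

text \<open>It is enough that \<open>x\<close> is below the top of slab \<open>i\<close> and
  \<open>y\<close> above the bottom of slab \<open>j\<close>, since their component takes all
  heights in between.\<close>

lemma open_slab_points:
  assumes xy: "(x, y) \<in> ord" "x \<in> W" "level n x < of_int i + 1" "of_int j < level n y" and ij: "i < j"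
    and W: "clopenin Y W"
  obtains x' y' where "x' \<in> W \<inter> open_slab n i" "y' \<in> W \<inter> open_slab n j" "(x', y') \<in> ord"
proof -
  \<comment> \<open>The midpoint of that part of the interval from \<open>i\<close> to
    \<open>i + 1\<close> which is above the level of \<open>x\<close>; symmetrically
    \<open>q\<close> is below the level of \<open>y\<close>.\<close>
  define p where "p = (max (level n x) i + (i + 1)) / 2"
  define q where "q = (j + min (level n y) (j + 1)) / 2"
  have ij': "real_of_int i + 1 \<le> real_of_int j" using ij by linarith
  have p: "level n x < p" "i < p" "p < i + 1" using xy(3) by (auto simp: p_def max_def)
  have q: "q < level n y" "j < q" "q < j + 1" using xy(4) by (auto simp: q_def min_def)
  obtain x' where x': "x' \<in> W" "connected_component_of Y x x'" "level n x' = p"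
    using level_point[OF xy(1,2) W, of n p] p q ij' by auto
  obtain y' where y': "y' \<in> W" "connected_component_of Y x y'" "level n y' = q"
    using level_point[OF xy(1,2) W, of n q] p q ij' by auto
  have T: "x' \<in> topspace Y" "y' \<in> topspace Y" using x' y' clopenin_subset[OF W] by auto
  have "connected_component_of Y x' y'"
    using x'(2) y'(2) connected_component_of_sym connected_component_of_trans by metis
  moreover have "h x' \<le> h y'" using x' y' p q ij' level_le_iff[of n x' y'] by simp
  ultimately have "(x', y') \<in> ord" using ord_iff[OF T] by simp
  then show thesis
    using that[of x' y'] x' y' p q T by (auto simp: open_slab_def)
qed

section \<open>Slabs met by a component, and partitions into dominated blocks\<close>

definition slabs_met :: "nat \<Rightarrow> 'a \<Rightarrow> int set"
  where "slabs_met n z = {j. \<exists>y\<in>slab n j. connected_component_of Y z y}"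

lemma slabs_met_component: "connected_component_of Y x y \<Longrightarrow> slabs_met n x = slabs_met n y"
  unfolding slabs_met_def by (metis connected_component_of_sym connected_component_of_trans)

lemma finite_slabs: "finite {j. slab n j \<noteq> {}}"
proof -
  obtain B where B: "B > 0" "\<And>z. z \<in> topspace Y \<Longrightarrow> \<bar>level n z\<bar> \<le> B"
    using bounded_continuous[OF continuous_level[of n]] by blast
  have "{j. slab n j \<noteq> {}} \<subseteq> {\<lfloor>- B\<rfloor> - 1..\<lceil>B\<rceil>}"
  proof
    fix j assume "j \<in> {j. slab n j \<noteq> {}}"
    then obtain z where "z \<in> slab n j" by blast
    then have "of_int j \<le> B" "- B \<le> of_int j + 1"
      using B(2)[of z] by (auto simp: slab_def abs_le_iff)
    then show "j \<in> {\<lfloor>- B\<rfloor> - 1..\<lceil>B\<rceil>}" by (simp; linarith)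
  qed
  then show ?thesis using finite_subset by blast
qed

lemma slabs_met_subset: "slabs_met n z \<subseteq> {j. slab n j \<noteq> {}}"
  by (auto simp: slabs_met_def)

text \<open>The union of the components that meet a slab is the up-set of the slab together with its
  down-set.\<close>

lemma closedin_slabs_met: "closedin Y {z \<in> topspace Y. j \<in> slabs_met n z}"
proof -
  have "{z \<in> topspace Y. j \<in> slabs_met n z} = ord `` slab n j \<union> ord\<inverse> `` slab n j"
  proof (intro equalityI subsetI)
    fix z assume "z \<in> {z \<in> topspace Y. j \<in> slabs_met n z}"
    then obtain y where y: "y \<in> slab n j" "connected_component_of Y z y" "z \<in> topspace Y"
      by (auto simp: slabs_met_def)
    then have "(z, y) \<in> ord \<or> (y, z) \<in> ord" using comparable by (auto simp: slab_def)
    then show "z \<in> ord `` slab n j \<union> ord\<inverse> `` slab n j" using y by blast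
  next
    fix z assume "z \<in> ord `` slab n j \<union> ord\<inverse> `` slab n j"
    then obtain y where y: "y \<in> slab n j" "(z, y) \<in> ord \<or> (y, z) \<in> ord" by blast
    then have "z \<in> topspace Y" "y \<in> topspace Y" using ord_in by auto
    then have "connected_component_of Y z y" "z \<in> topspace Y" using comparable y(2) by blast+
    then show "z \<in> {z \<in> topspace Y. j \<in> slabs_met n z}" using y by (auto simp: slabs_met_def)
  qed
  then show ?thesis using closedin_ord_Image[OF closedin_slab] by auto
qed

text \<open>A point meets the slabs in which it lies, so the component of \<open>c\<close> meets
  every slab that \<open>W\<close> meets.\<close>

definition dominated :: "nat \<Rightarrow> 'a set \<Rightarrow> bool"
  where "dominated n W \<longleftrightarrow> clopenin Y W \<and> (\<exists>c\<in>W. \<forall>z\<in>W. slabs_met n z \<subseteq> slabs_met n c)"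

text \<open>Let \<open>S\<close> be maximal among the sets of slabs met by components in
  \<open>V\<close>. No component there meets all of \<open>S\<close> and a further slab, so a clopen
  \<open>W\<close> can gather the components meeting all of \<open>S\<close> and avoid those meeting
  a slab outside \<open>S\<close>. On the rest of \<open>V\<close> the value \<open>S\<close> no
  longer occurs, and the number of values has dropped.\<close>

lemma dominated_partition:
  assumes "clopenin Y V"
  shows "\<exists>\<W>. finite \<W> \<and> \<Union>\<W> = V \<and> disjoint \<W> \<and> (\<forall>W\<in>\<W>. dominated n W)"
  using assms
proof (induction "card (slabs_met n ` V)" arbitrary: V rule: less_induct)
  case less
  show ?case
  proof (cases "V = {}")
    case True
    then show ?thesis by (intro exI[of _ "{}"]) auto
  next
    case False
    have "slabs_met n ` V \<subseteq> Pow {j. slab n j \<noteq> {}}" using slabs_met_subset by blast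
    then have fin: "finite (slabs_met n ` V)"
      using finite_slabs by (meson finite_Pow_iff finite_subset)
    then obtain S where S: "S \<in> slabs_met n ` V" "\<forall>S'\<in>slabs_met n ` V. S \<subseteq> S' \<longrightarrow> S = S'"
      using finite_has_maximal[of "slabs_met n ` V"] False by auto
    let ?F = "\<lambda>j. {z \<in> topspace Y. j \<in> slabs_met n z}"
    \<comment> \<open>Inserting \<open>V\<close> keeps the family nonempty whatever \<open>S\<close>
      is.\<close>
    let ?A = "\<Inter>(insert V ((\<lambda>j. V \<inter> ?F j) ` S))"
    let ?B = "(\<Union>j\<in>{j. slab n j \<noteq> {}} - S. ?F j) \<union> (topspace Y - V)"
    have A: "z \<in> ?A \<longleftrightarrow> z \<in> V \<and> S \<subseteq> slabs_met n z" for z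
      using clopenin_subset[OF less.prems] by auto
    have "closedin Y ?A"
      using less.prems closedin_slabs_met by (intro closedin_Inter) (auto simp: clopenin_def)
    moreover have "closedin Y ?B"
      using less.prems closedin_slabs_met finite_slabs[of n]
      by (intro closedin_Un closedin_Union) (auto simp: clopenin_def)
    moreover have False if x: "x \<in> ?A" and y: "y \<in> ?B" and xy: "connected_component_of Y x y" for x y
    proof -
      have xV: "x \<in> V" "S \<subseteq> slabs_met n x" using A[of x] x by simp_all
      then have "S = slabs_met n x" using S(2) by blast
      then have "S = slabs_met n y" using slabs_met_component[OF xy] by simp
      moreover have "y \<in> V" using clopen_component[OF less.prems xy] xV by simp
      ultimately show False using y by auto
    qed
    ultimately obtain W where Wc: "clopenin Y W" and W: "?A \<subseteq> W" "W \<inter> ?B = {}"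
      by (rule clopen_separation)
    have WV: "W \<subseteq> V" using W(2) clopenin_subset[OF Wc] by blast
    have sub: "slabs_met n z \<subseteq> S" if "z \<in> W" for z
    proof (rule subsetI, rule ccontr)
      fix j assume j: "j \<in> slabs_met n z" "j \<notin> S"
      moreover have "slab n j \<noteq> {}" using slabs_met_subset j(1) by blast
      ultimately have "z \<in> ?B" using that clopenin_subset[OF Wc] by auto
      then show False using W(2) that by blast
    qed
    obtain c where c: "c \<in> V" "slabs_met n c = S" using S(1) by blast
    then have "c \<in> ?A" unfolding A by simp
    then have "c \<in> W" using W(1) by (rule subsetD[rotated])
    then have dom: "dominated n W" unfolding dominated_def using Wc sub c by blast
    have VW: "clopenin Y (V - W)" using clopenin_diff less.prems Wc by blast
    have "S \<notin> slabs_met n ` (V - W)"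
    proof
      assume "S \<in> slabs_met n ` (V - W)"
      then obtain z where "z \<in> V - W" "slabs_met n z = S" by blast
      then have "z \<in> ?A" unfolding A by simp
      then have "z \<in> W" using W(1) by (rule subsetD[rotated])
      then show False using \<open>z \<in> V - W\<close> by simp
    qed
    then have "slabs_met n ` (V - W) \<subset> slabs_met n ` V" using S(1) by blast
    then have "card (slabs_met n ` (V - W)) < card (slabs_met n ` V)"
      by (rule psubset_card_mono[OF fin])
    from less.hyps[OF this VW] obtain \<W> where \<W>: "finite \<W>" "\<Union>\<W> = V - W" "disjoint \<W>"
      "\<forall>W\<in>\<W>. dominated n W" by (elim exE conjE)
    show ?thesis
    proof (intro exI[of _ "insert W \<W>"] conjI)
      show "disjoint (insert W \<W>)"
        using \<W>(2,3) by (auto simp: pairwise_insert disjnt_def)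
    qed (use \<W> dom WV in auto)
  qed
qed

definition partition :: "nat \<Rightarrow> 'a set set \<Rightarrow> bool"
  where "partition n \<W> \<longleftrightarrow> finite \<W> \<and> \<Union>\<W> = topspace Y \<and> disjoint \<W> \<and> (\<forall>W\<in>\<W>. dominated n W)"

text \<open>Cutting every block along \<open>E\<close> leaves clopen pieces, and these are
  subdivided into dominated ones.\<close>

lemma refine_partition:
  assumes \<V>: "finite \<V>" "\<Union>\<V> = topspace Y" "disjoint \<V>" "\<And>V. V \<in> \<V> \<Longrightarrow> clopenin Y V"
    and E: "clopenin Y E"
  shows "\<exists>\<W>. partition n \<W> \<and> (\<forall>W\<in>\<W>. \<exists>V\<in>\<V>. W \<subseteq> V \<and> (W \<subseteq> E \<or> disjnt W E))"
proof -
  let ?U = "(\<lambda>V. V \<inter> E) ` \<V> \<union> (\<lambda>V. V - E) ` \<V>"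
  have "clopenin Y U" if "U \<in> ?U" for U
    using that \<V>(4) E clopenin_Int clopenin_diff by blast
  then have "\<forall>U\<in>?U. \<exists>\<W>. finite \<W> \<and> \<Union>\<W> = U \<and> disjoint \<W> \<and> (\<forall>W\<in>\<W>. dominated n W)"
    by (intro ballI dominated_partition)
  from bchoice[OF this] obtain f where
    "\<forall>U\<in>?U. finite (f U) \<and> \<Union>(f U) = U \<and> disjoint (f U) \<and> (\<forall>W\<in>f U. dominated n W)"
    by (elim exE)
  note f = bspec[OF this]
  have disjU: "A \<inter> B = {}" if "A \<in> ?U" "B \<in> ?U" "A \<noteq> B" for A B
  proof -
    have *: "V \<inter> V' = {}" if "V \<in> \<V>" "V' \<in> \<V>" "V \<noteq> V'" for V V'
      using \<V>(3) that by (auto simp: pairwise_def disjnt_def)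
    obtain V V' where V: "V \<in> \<V>" "A = V \<inter> E \<or> A = V - E" "V' \<in> \<V>" "B = V' \<inter> E \<or> B = V' - E"
      using \<open>A \<in> ?U\<close> \<open>B \<in> ?U\<close> by blast
    show ?thesis
      using *[OF V(1,3)] V \<open>A \<noteq> B\<close> by (cases "V = V'") auto
  qed
  show ?thesis
  proof (intro exI[of _ "\<Union>(f ` ?U)"] conjI)
    show "partition n (\<Union>(f ` ?U))"
      unfolding partition_def
    proof (intro conjI)
      show "finite (\<Union>(f ` ?U))" using f \<V>(1) by (intro finite_UN_I) auto
      have "\<Union>(\<Union>(f ` ?U)) = (\<Union>U\<in>?U. \<Union>(f U))" by blast
      also have "\<dots> = (\<Union>U\<in>?U. U)" by (rule SUP_cong[OF refl]) (use f in blast)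
      also have "\<dots> = \<Union>\<V>" by blast
      also have "\<dots> = topspace Y" by (rule \<V>(2))
      finally show "\<Union>(\<Union>(f ` ?U)) = topspace Y" .
      show "disjoint (\<Union>(f ` ?U))"
        unfolding pairwise_def
      proof (intro ballI impI)
        fix W W' assume "W \<in> \<Union>(f ` ?U)" "W' \<in> \<Union>(f ` ?U)" "W \<noteq> W'"
        then obtain A B where AB: "A \<in> ?U" "B \<in> ?U" "W \<in> f A" "W' \<in> f B" by blast
        have "W \<subseteq> A" "W' \<subseteq> B" using f AB by blast+
        show "disjnt W W'"
        proof (cases "A = B")
          case True
          then show ?thesis using f[OF AB(1)] AB \<open>W \<noteq> W'\<close> by (simp add: pairwise_def)
        next
          case False
          then show ?thesis using disjU[OF AB(1,2)] \<open>W \<subseteq> A\<close> \<open>W' \<subseteq> B\<close> unfolding disjnt_def by blast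
        qed
      qed
      show "\<forall>W\<in>\<Union>(f ` ?U). dominated n W" using f by blast
    qed
    show "\<forall>W\<in>\<Union>(f ` ?U). \<exists>V\<in>\<V>. W \<subseteq> V \<and> (W \<subseteq> E \<or> disjnt W E)"
    proof
      fix W assume "W \<in> \<Union>(f ` ?U)"
      then obtain A where A: "A \<in> ?U" "W \<in> f A" by blast
      then have "W \<subseteq> A" using f by blast
      then show "\<exists>V\<in>\<V>. W \<subseteq> V \<and> (W \<subseteq> E \<or> disjnt W E)"
        using A(1) unfolding disjnt_def by blast
    qed
  qed
qed

text \<open>The countably many clopen sets take turns as cutting sets, so each of them is eventually
  a union of blocks; this will separate points of different components.\<close>

lemma ex_partitions:
  obtains \<W> where "\<And>n. partition n (\<W> n)"
    "\<And>n W. W \<in> \<W> (Suc n) \<Longrightarrow> \<exists>V\<in>\<W> n. W \<subseteq> V"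
    "\<And>E. clopenin Y E \<Longrightarrow> \<exists>n. \<forall>W\<in>\<W> n. W \<subseteq> E \<or> disjnt W E"
proof -
  define E where "E = from_nat_into {E. clopenin Y E}"
  have E: "range E = {E. clopenin Y E}"
    unfolding E_def using countable_clopenin[OF compact second_countable] clopenin_topspace[of Y]
    by (intro range_from_nat_into) auto
  then have Ec: "clopenin Y (E n)" for n by blast
  \<comment> \<open>Domination refers to the slabs of one stage only, so it is arranged anew
    whenever the stage increases.\<close>
  let ?Q = "\<lambda>n \<V> \<W>. \<forall>W\<in>\<W>. \<exists>V\<in>\<V>. W \<subseteq> V \<and> (W \<subseteq> E n \<or> disjnt W (E n))"
  have "\<exists>\<W>. partition 0 \<W> \<and> (\<forall>W\<in>\<W>. \<exists>V\<in>{topspace Y}. W \<subseteq> V \<and> (W \<subseteq> topspace Y \<or> disjnt W (topspace Y)))"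
    by (rule refine_partition) (auto simp: clopenin_topspace)
  then have "\<exists>\<W>. partition 0 \<W>" by (elim exE conjE) (rule exI)
  moreover have "\<exists>\<W>. partition (Suc n) \<W> \<and> ?Q n \<V> \<W>" if "partition n \<V>" for n \<V>
    using that Ec refine_partition[of \<V> "E n" "Suc n"] by (auto simp: partition_def dominated_def)
  ultimately obtain \<W> where \<W>: "\<And>n. partition n (\<W> n)" "\<And>n. ?Q n (\<W> n) (\<W> (Suc n))"
    using dependent_nat_choice[of partition ?Q] by metis
  show thesis
  proof (rule that[OF \<W>(1)])
    show "\<exists>V\<in>\<W> n. W \<subseteq> V" if "W \<in> \<W> (Suc n)" for n W
      using \<W>(2) that by blast
    fix A assume "clopenin Y A"
    then obtain n where "A = E n" using E by blast
    then show "\<exists>n. \<forall>W\<in>\<W> n. W \<subseteq> A \<or> disjnt W A" using \<W>(2) by blast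
  qed
qed

end

section \<open>The cells of a partitioned fence\<close>


locale partitioned_fence = height_space +
  fixes \<W> :: "nat \<Rightarrow> 'a set set"
  assumes partition: "partition n (\<W> n)"
    and nested: "W \<in> \<W> (Suc n) \<Longrightarrow> \<exists>V\<in>\<W> n. W \<subseteq> V"
    and separating: "clopenin Y E \<Longrightarrow> \<exists>n. \<forall>W\<in>\<W> n. W \<subseteq> E \<or> disjnt W E"
begin

lemma clopen: "W \<in> \<W> n \<Longrightarrow> clopenin Y W"
  using partition[of n] by (simp add: partition_def dominated_def)

lemma block_unique: "\<lbrakk>V \<in> \<W> n; W \<in> \<W> n; z \<in> V; z \<in> W\<rbrakk> \<Longrightarrow> V = W"
  using partition[of n] by (auto simp: partition_def pairwise_def disjnt_def)

definition block :: "nat \<Rightarrow> 'a \<Rightarrow> 'a set"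
  where "block n z = (THE W. W \<in> \<W> n \<and> z \<in> W)"

lemma block:
  assumes "z \<in> topspace Y"
  shows "block n z \<in> \<W> n" "z \<in> block n z"
proof -
  have "z \<in> \<Union>(\<W> n)" using partition[of n] assms by (simp add: partition_def)
  then obtain W where W: "W \<in> \<W> n" "z \<in> W" by blast
  then have "block n z = W"
    unfolding block_def using block_unique by (intro the_equality) blast+
  then show "block n z \<in> \<W> n" "z \<in> block n z" using W by auto
qed

lemma block_eq: "W \<in> \<W> n \<Longrightarrow> z \<in> W \<Longrightarrow> block n z = W"
  using block block_unique clopenin_subset[OF clopen] by (meson subsetD)

lemma block_nested:
  assumes "W \<in> \<W> (Suc n)" "z \<in> W"
  shows "W \<subseteq> block n z"
proof -
  obtain V where V: "V \<in> \<W> n" "W \<subseteq> V" using nested[OF assms(1)] by blast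
  then show ?thesis using block_eq[OF V(1), of z] assms(2) by auto
qed

definition cells :: "nat \<Rightarrow> ('a set \<times> int) set"
  where "cells n = {(W, j). W \<in> \<W> n \<and> W \<inter> slab n j \<noteq> {}}"

lemma cellsD: "(W, j) \<in> cells n \<Longrightarrow> W \<in> \<W> n" "(W, j) \<in> cells n \<Longrightarrow> W \<inter> slab n j \<noteq> {}"
  by (auto simp: cells_def)

lemma cells_clopen: "(W, j) \<in> cells n \<Longrightarrow> clopenin Y W"
  using cellsD(1) clopen by blast

lemma cellsI: "W \<in> \<W> n \<Longrightarrow> z \<in> W \<Longrightarrow> z \<in> slab n j \<Longrightarrow> (W, j) \<in> cells n"
  by (auto simp: cells_def)

lemma finite_cells: "finite (cells n)"
proof (rule finite_subset)
  show "cells n \<subseteq> \<W> n \<times> {j. slab n j \<noteq> {}}" by (auto simp: cells_def)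
  show "finite (\<W> n \<times> {j. slab n j \<noteq> {}})"
    using partition[of n] finite_slabs by (simp add: partition_def)
qed

text \<open>All structures of the sequence live on one type. As there are countably many clopen
  sets, the labels can be natural numbers, decoded in the same way at every stage.\<close>

definition code :: "'a set \<times> int \<Rightarrow> nat"
  where "code = to_nat_on ({W. clopenin Y W} \<times> UNIV)"

definition cell :: "nat \<Rightarrow> nat \<Rightarrow> 'a set"
  where "cell n a = (case from_nat_into ({W. clopenin Y W} \<times> UNIV) a of (W, j) \<Rightarrow> W \<inter> slab n j)"

lemma countable_labels: "countable ({W. clopenin Y W} \<times> (UNIV :: int set))"
  using countable_clopenin[OF compact second_countable] by (rule countable_SIGMA) simp

lemma cell_code: "clopenin Y W \<Longrightarrow> cell n (code (W, j)) = W \<inter> slab n j"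
  unfolding cell_def code_def using countable_labels by simp

lemma inj_on_code: "inj_on code (cells n)"
proof -
  have "inj_on code ({W. clopenin Y W} \<times> UNIV)"
    unfolding code_def by (rule inj_on_to_nat_on[OF countable_labels])
  then show ?thesis by (rule inj_on_subset) (auto simp: cells_def clopen)
qed

lemma open_cell_nonempty:
  assumes "(W, j) \<in> cells n"
  obtains x where "x \<in> W \<inter> open_slab n j"
proof -
  have "W \<inter> open_slab n j \<noteq> {}"
    using cellsD(2)[OF assms] closure_open_slab[OF cells_clopen[OF assms], of n j]
    by (metis closure_of_empty)
  then show thesis using that by blast
qed

text \<open>The dominating component meets both slabs, so it touches the levels \<open>i + 1\<close>
  and \<open>j\<close>, which may coincide. Genericity turns this into a strict crossing, possibly
  by another component in \<open>W\<close>.\<close>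

lemma crossing:
  assumes i: "(W, i) \<in> cells n" and j: "(W, j) \<in> cells n" and ij: "i < j"
  obtains x y where "x \<in> W" "y \<in> W" "(x, y) \<in> ord" "level n x < of_int i + 1" "of_int j < level n y"
proof -
  have W: "W \<in> \<W> n" "clopenin Y W" using cellsD(1) cells_clopen i by auto
  obtain c where c: "c \<in> W" "\<And>z. z \<in> W \<Longrightarrow> slabs_met n z \<subseteq> slabs_met n c"
    using partition[of n] W by (auto simp: partition_def dominated_def)
  have met: "k \<in> slabs_met n c" if k: "(W, k) \<in> cells n" for k
  proof -
    obtain z where z: "z \<in> W" "z \<in> slab n k" using cellsD(2)[OF k] by blast
    then have "connected_component_of Y z z"
      by (simp add: connected_component_of_refl slab_def)
    then have "k \<in> slabs_met n z" using z(2) by (auto simp: slabs_met_def)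
    then show ?thesis using c(2)[OF z(1)] by blast
  qed
  obtain x where x: "x \<in> slab n i" "connected_component_of Y c x"
    using met[OF i] by (auto simp: slabs_met_def)
  obtain y where y: "y \<in> slab n j" "connected_component_of Y c y"
    using met[OF j] by (auto simp: slabs_met_def)
  have xy: "x \<in> W" "y \<in> W" "x \<in> topspace Y" "y \<in> topspace Y"
    using clopen_component[OF W(2) x(2)] clopen_component[OF W(2) y(2)] c(1) x(1) y(1)
    by (auto simp: slab_def)
  have lv: "level n x \<le> of_int i + 1" "of_int i + 1 \<le> real_of_int j" "of_int j \<le> level n y"
    using x(1) y(1) ij by (auto simp: slab_def)
  then have "h x \<le> h y" by (simp flip: level_le_iff[of n])
  moreover have "connected_component_of Y x y"
    using x(2) y(2) connected_component_of_sym connected_component_of_trans by metis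
  ultimately have "(x, y) \<in> ord" using ord_iff xy by simp
  then have "touched h W ((of_int i + 1) / 2 ^ n) (of_int j / 2 ^ n)"
    unfolding touched_def using xy lv by (force simp: level_def field_simps)
  moreover have "(of_int i + 1) / 2 ^ n \<le> real_of_int j / 2 ^ n"
    using lv(2) by (intro divide_right_mono) auto
  moreover have "(real_of_int i + 1) / 2 ^ n \<in> \<rat>" "real_of_int j / 2 ^ n \<in> \<rat>" by simp_all
  ultimately have "crossed h W ((of_int i + 1) / 2 ^ n) (of_int j / 2 ^ n)"
    using generic_h[OF W(2)] by blast
  then obtain x' y' where "x' \<in> W" "y' \<in> W" "(x', y') \<in> ord"
    "h x' < (of_int i + 1) / 2 ^ n" "of_int j / 2 ^ n < h y'"
    unfolding crossed_def by blast
  then show thesis using that[of x' y'] by (simp add: level_def field_simps)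
qed

lemma cells_convex:
  assumes "(W, i) \<in> cells n" "(W, j) \<in> cells n" "i < k" "k < j"
  shows "(W, k) \<in> cells n"
proof -
  obtain x y where xy: "x \<in> W" "y \<in> W" "(x, y) \<in> ord" "level n x < of_int i + 1" "of_int j < level n y"
    using crossing[OF assms(1,2)] assms(3,4) by (metis less_trans)
  have W: "W \<in> \<W> n" "clopenin Y W" using cellsD(1) cells_clopen assms(1) by auto
  have "level n x \<le> of_int k" "of_int k \<le> level n y" using xy assms(3,4) by linarith+
  then obtain w where w: "w \<in> W" "level n w = of_int k"
    using level_point[OF xy(3,1) W(2)] by metis
  then have "w \<in> slab n k" using clopenin_subset[OF W(2)] by (auto simp: slab_def)
  then show ?thesis using cellsI W w by blast
qed

text \<open>Neighbouring cells of a block meet because a crossing component passes through the level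
  between them.\<close>

lemma cell_R_iff:
  assumes i: "(W, i) \<in> cells n" and j: "(V, j) \<in> cells n"
  shows "cell n (code (W, i)) \<inter> cell n (code (V, j)) \<noteq> {} \<longleftrightarrow> W = V \<and> \<bar>i - j\<bar> \<le> 1"
proof -
  have W: "W \<in> \<W> n" "clopenin Y W" and V: "V \<in> \<W> n" "clopenin Y V" using cellsD(1) cells_clopen i j by auto
  have adj: "W \<inter> slab n k \<inter> slab n (k + 1) \<noteq> {}" if k: "(W, k) \<in> cells n" "(W, k + 1) \<in> cells n" for k
  proof -
    obtain x y where xy: "x \<in> W" "y \<in> W" "(x, y) \<in> ord" "level n x < of_int k + 1" "of_int (k + 1) < level n y"
      using crossing[OF k] by auto
    have "level n x \<le> of_int (k + 1)" "of_int (k + 1) \<le> level n y" using xy by simp_all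
    then obtain w where w: "w \<in> W" "level n w = of_int (k + 1)"
      using level_point[OF xy(3,1) W(2)] by metis
    then have "w \<in> slab n k \<inter> slab n (k + 1)" using clopenin_subset[OF W(2)] by (auto simp: slab_def)
    then show ?thesis using w(1) by blast
  qed
  have "(W \<inter> slab n i) \<inter> (V \<inter> slab n j) \<noteq> {} \<longleftrightarrow> W = V \<and> \<bar>i - j\<bar> \<le> 1"
  proof
    assume "(W \<inter> slab n i) \<inter> (V \<inter> slab n j) \<noteq> {}"
    then obtain z where z: "z \<in> W" "z \<in> V" "z \<in> slab n i" "z \<in> slab n j" by blast
    then have "real_of_int i \<le> j + 1" "real_of_int j \<le> i + 1" by (auto simp: slab_def)
    then have "\<bar>i - j\<bar> \<le> 1" by linarith
    then show "W = V \<and> \<bar>i - j\<bar> \<le> 1" using block_unique W V z by blast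
  next
    assume "W = V \<and> \<bar>i - j\<bar> \<le> 1"
    then consider "W = V" "i = j" | "W = V" "j = i + 1" | "W = V" "i = j + 1" by linarith
    then show "(W \<inter> slab n i) \<inter> (V \<inter> slab n j) \<noteq> {}"
    proof cases
      case 1
      then show ?thesis using cellsD(2)[OF i] by simp
    next
      case 2
      then show ?thesis using adj[of i] i j by blast
    next
      case 3
      then show ?thesis using adj[of j] i j by blast
    qed
  qed
  then show ?thesis using cell_code W V by simp
qed

definition idx :: "nat \<Rightarrow> nat set"
  where "idx n = code ` cells n"

text \<open>Related points lie in one block and their heights are ordered. Conversely, for
  \<open>i < j\<close> a crossing component visits both open slabs in the right order.\<close>

lemma cell_le_iff:
  assumes i: "(W, i) \<in> cells n" and j: "(V, j) \<in> cells n"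
  shows "(code (W, i), code (V, j)) \<in> cell_le Y ord (idx n) (cell n) \<longleftrightarrow> W = V \<and> i \<le> j"
proof -
  have W: "W \<in> \<W> n" "clopenin Y W" and V: "V \<in> \<W> n" "clopenin Y V" using cellsD(1) cells_clopen i j by auto
  have "(\<exists>x\<in>W \<inter> open_slab n i. \<exists>y\<in>V \<inter> open_slab n j. (x, y) \<in> ord) \<longleftrightarrow> W = V \<and> i \<le> j"
  proof
    assume "\<exists>x\<in>W \<inter> open_slab n i. \<exists>y\<in>V \<inter> open_slab n j. (x, y) \<in> ord"
    then obtain x y where x: "x \<in> W" "x \<in> open_slab n i" and y: "y \<in> V" "y \<in> open_slab n j"
      and xy: "(x, y) \<in> ord" by blast
    have "y \<in> W" using clopen_ord[OF W(2) xy] x by simp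
    then have "W = V" using block_unique W V y by blast
    moreover have "level n x \<le> level n y"
      using ord_iff xy x y by (auto simp: level_le_iff open_slab_def)
    then have "real_of_int i < j + 1" using x y by (auto simp: open_slab_def)
    then have "i \<le> j" by linarith
    ultimately show "W = V \<and> i \<le> j" by simp
  next
    assume "W = V \<and> i \<le> j"
    then consider "W = V" "i = j" | "W = V" "i < j" by linarith
    then show "\<exists>x\<in>W \<inter> open_slab n i. \<exists>y\<in>V \<inter> open_slab n j. (x, y) \<in> ord"
    proof cases
      case 1
      obtain x where x: "x \<in> W \<inter> open_slab n i" using open_cell_nonempty[OF i] .
      then have "(x, x) \<in> ord" using ord_refl by (auto simp: open_slab_def)
      then show ?thesis using 1 x by blast
    next
      case 2
      obtain x y where xy: "x \<in> W" "y \<in> W" "(x, y) \<in> ord" "level n x < of_int i + 1" "of_int j < level n y"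
        using crossing[OF i] j 2 by blast
      from open_slab_points[OF xy(3,1,4,5) 2(2) W(2)] 2(1) show ?thesis by blast
    qed
  qed
  then show ?thesis
    using i j by (simp add: cell_le_def idx_def cell_code W V interior_slab)
qed

text \<open>Integer \<open>div\<close> rounds down for negative \<open>k\<close> as well, so
  \<open>k div 2\<close> is always the slab of which \<open>k\<close> is a half.\<close>

lemma slab_refine: "slab (Suc n) k \<subseteq> slab n (k div 2)"
proof
  fix z assume "z \<in> slab (Suc n) k"
  then have z: "z \<in> topspace Y" "real_of_int k \<le> 2 * level n z" "2 * level n z \<le> real_of_int k + 1"
    by (auto simp: slab_def level_Suc)
  have "real_of_int (2 * (k div 2)) \<le> real_of_int k" "real_of_int k \<le> real_of_int (2 * (k div 2) + 1)"
    unfolding of_int_le_iff by linarith+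
  then show "z \<in> slab n (k div 2)" using z by (auto simp: slab_def)
qed

lemma cell_refine:
  assumes k: "(W, k) \<in> cells (Suc n)" and z: "z \<in> W"
  shows "(block n z, k div 2) \<in> cells n"
    "cell (Suc n) (code (W, k)) \<subseteq> cell n (code (block n z, k div 2))"
proof -
  have W: "W \<in> \<W> (Suc n)" "clopenin Y W" using cellsD(1) cells_clopen k by auto
  have sub: "W \<subseteq> block n z" using block_nested W(1) z by blast
  have V: "block n z \<in> \<W> n" using block z clopenin_subset[OF W(2)] by blast
  obtain w where "w \<in> W \<inter> slab (Suc n) k" using cellsD(2)[OF k] by blast
  then show "(block n z, k div 2) \<in> cells n"
    using cellsI[OF V, of w] sub slab_refine[of n k] by blast
  show "cell (Suc n) (code (W, k)) \<subseteq> cell n (code (block n z, k div 2))"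
    using sub slab_refine[of n k] by (auto simp: cell_code W clopen[OF V])
qed

text \<open>Rounding down puts a point at an integer level into the upper of its two slabs. This
  choice is monotone in the height and compatible with halving, as \<open>section_mono\<close> and
  \<open>section_nested\<close> require.\<close>

definition address :: "'a \<Rightarrow> nat \<Rightarrow> nat"
  where "address z n = code (block n z, \<lfloor>level n z\<rfloor>)"

lemma floor_slab: "z \<in> topspace Y \<Longrightarrow> z \<in> slab n \<lfloor>level n z\<rfloor>"
  by (simp add: slab_def)

lemma floor_cells: "z \<in> topspace Y \<Longrightarrow> (block n z, \<lfloor>level n z\<rfloor>) \<in> cells n"
  using cellsI block floor_slab by blast

lemma floor_level_Suc: "\<lfloor>level (Suc n) z\<rfloor> div 2 = \<lfloor>level n z\<rfloor>"
  using floor_divide_real_eq_div[of 2 "level (Suc n) z"] by (simp add: level_Suc)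

text \<open>Points of one component differ in height and are separated once the slabs are thin
  enough; points of different components are separated by a clopen set that some partition
  respects.\<close>

lemma ex_separating_level:
  assumes x: "x \<in> topspace Y" and y: "y \<in> topspace Y" and "x \<noteq> y"
  shows "\<exists>n. \<forall>a\<in>idx n. \<not> (x \<in> cell n a \<and> y \<in> cell n a)"
proof (cases "connected_component_of Y x y")
  case True
  then have "h x \<noteq> h y"
    using ord_iff[OF x y] ord_iff[OF y x] strict_h \<open>x \<noteq> y\<close> connected_component_of_sym[of Y x y]
    unfolding strictly_isotone_def by fastforce
  then have "0 < \<bar>h x - h y\<bar>" by simp
  then obtain n where "(1/2::real) ^ n < \<bar>h x - h y\<bar>"
    using real_arch_pow_inv[of "\<bar>h x - h y\<bar>" "1/2"] by auto
  then have "1 < 2 ^ n * \<bar>h x - h y\<bar>" by (simp add: field_simps)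
  also have "2 ^ n * \<bar>h x - h y\<bar> = \<bar>level n x - level n y\<bar>"
    by (simp add: level_def abs_mult flip: right_diff_distrib)
  finally have "\<bar>level n x - level n y\<bar> > 1" .
  then have "\<not> (x \<in> slab n j \<and> y \<in> slab n j)" for j
    by (auto simp: slab_def)
  then have "\<forall>a\<in>idx n. \<not> (x \<in> cell n a \<and> y \<in> cell n a)"
    by (auto simp: idx_def cell_code clopen dest!: cellsD(1))
  then show ?thesis by blast
next
  case False
  then have "\<not> quasi_component_of Y x y"
    using quasi_eq_connected_component_of[of Y x] compact Hausdorff by simp
  then obtain E where E: "clopenin Y E" "x \<in> E" "y \<notin> E"
    using x y by (auto simp: quasi_component_nonseparated separated_between clopenin_def)
  then obtain n where n: "\<forall>W\<in>\<W> n. W \<subseteq> E \<or> disjnt W E" using separating by blast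
  have "\<not> (x \<in> W \<and> y \<in> W)" if "W \<in> \<W> n" for W
    using n that E by (auto simp: disjnt_iff)
  then have "\<forall>a\<in>idx n. \<not> (x \<in> cell n a \<and> y \<in> cell n a)"
    by (auto simp: idx_def cell_code clopen dest!: cellsD(1))
  then show ?thesis by blast
qed

text \<open>For \<open>i = j\<close> any interior point gives a cell of the next stage related to
  itself. For \<open>i < j\<close> a crossing component lies in a single block of the next stage and
  supplies both cells.\<close>

lemma le_lift:
  assumes "(a, b) \<in> cell_le Y ord (idx n) (cell n)"
  shows "\<exists>a' b'. (a', b') \<in> cell_le Y ord (idx (Suc n)) (cell (Suc n)) \<and>
    cell (Suc n) a' \<subseteq> cell n a \<and> cell (Suc n) b' \<subseteq> cell n b"
proof -
  obtain W V i j where a: "a = code (W, i)" "(W, i) \<in> cells n" and b: "b = code (V, j)" "(V, j) \<in> cells n"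
    using assms by (auto simp: cell_le_def idx_def)
  then have VW: "V = W" and ij: "i \<le> j" using assms cell_le_iff by auto
  have W: "W \<in> \<W> n" "clopenin Y W" using cellsD(1) cells_clopen a by auto
  show ?thesis
  proof (cases "i = j")
    case True
    obtain x where x: "x \<in> W" "x \<in> open_slab n i" using open_cell_nonempty[OF a(2)] by blast
    then have xY: "x \<in> topspace Y" by (simp add: open_slab_def)
    let ?k = "\<lfloor>level (Suc n) x\<rfloor>"
    have "(address x (Suc n), address x (Suc n)) \<in> cell_le Y ord (idx (Suc n)) (cell (Suc n))"
      using cell_le_iff[OF floor_cells[OF xY] floor_cells[OF xY]] by (simp add: address_def)
    moreover have "cell (Suc n) (address x (Suc n)) \<subseteq> cell n (code (block n x, ?k div 2))"
      unfolding address_def using cell_refine(2)[OF floor_cells[OF xY]] block xY by blast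
    moreover have "?k div 2 = i"
      unfolding floor_level_Suc using x(2) by (simp add: open_slab_def) linarith
    ultimately show ?thesis using a b VW True block_eq[OF W(1) x(1)] by auto
  next
    case False
    then have "i < j" using ij by simp
    then obtain x y where xy: "x \<in> W" "y \<in> W" "(x, y) \<in> ord" "level n x < of_int i + 1" "of_int j < level n y"
      using crossing[OF a(2)] b VW by blast
    have xY: "x \<in> topspace Y" using xy ord_in by blast
    let ?W = "block (Suc n) x"
    have W': "?W \<in> \<W> (Suc n)" "x \<in> ?W" "clopenin Y ?W" using block xY clopen by blast+
    \<comment> \<open>The upper half of slab \<open>i\<close> and the lower half of slab
      \<open>j\<close>: the pair is only known to lie below \<open>i + 1\<close> and above
      \<open>j\<close>, and its component is sure to reach these halves.\<close>
    have "level (Suc n) x < of_int (2 * i + 1) + 1" "of_int (2 * j) < level (Suc n) y" "2 * i + 1 < 2 * j"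
      using xy \<open>i < j\<close> by (simp_all add: level_Suc)
    from open_slab_points[OF xy(3) W'(2) this W'(3)]
    obtain x' y' where x': "x' \<in> ?W" "x' \<in> open_slab (Suc n) (2 * i + 1)"
      and y': "y' \<in> ?W" "y' \<in> open_slab (Suc n) (2 * j)" by blast
    have c: "(?W, 2 * i + 1) \<in> cells (Suc n)" "(?W, 2 * j) \<in> cells (Suc n)"
      using cellsI[OF W'(1) x'(1)] cellsI[OF W'(1) y'(1)] x'(2) y'(2) by (auto simp: slab_def open_slab_def)
    have "(code (?W, 2 * i + 1), code (?W, 2 * j)) \<in> cell_le Y ord (idx (Suc n)) (cell (Suc n))"
      using cell_le_iff[OF c] \<open>i < j\<close> by simp
    moreover have "cell (Suc n) (code (?W, 2 * i + 1)) \<subseteq> cell n a" "cell (Suc n) (code (?W, 2 * j)) \<subseteq> cell n b"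
      using cell_refine(2)[OF c(1) W'(2)] cell_refine(2)[OF c(2) W'(2)] block_eq[OF W(1) xy(1)] a b VW
      by simp_all
    ultimately show ?thesis by blast
  qed
qed

sublocale cell_system Y ord idx cell address
proof
  show "compact_space Y" "Hausdorff_space Y" "closedin (prod_topology Y Y) ord"
    using compact Hausdorff ord_closed by auto
  show "finite (idx n)" for n by (simp add: idx_def finite_cells)
  fix n a assume "a \<in> idx n"
  then obtain W j where a: "a = code (W, j)" "(W, j) \<in> cells n" by (auto simp: idx_def)
  then have W: "clopenin Y W" using cells_clopen by blast
  show "Y closure_of (Y interior_of cell n a) = cell n a"
    using W by (simp add: a cell_code interior_slab closure_open_slab)
  show "cell n a \<noteq> {}" using W cellsD(2)[OF a(2)] by (simp add: a cell_code)
  fix b assume "b \<in> idx n" "a \<noteq> b"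
  then obtain V i where b: "b = code (V, i)" "(V, i) \<in> cells n" by (auto simp: idx_def)
  then have V: "clopenin Y V" using cells_clopen by blast
  have "(W \<inter> open_slab n j) \<inter> (V \<inter> open_slab n i) = {}"
  proof (rule ccontr)
    assume "(W \<inter> open_slab n j) \<inter> (V \<inter> open_slab n i) \<noteq> {}"
    then obtain z where z: "z \<in> W" "z \<in> V" "z \<in> open_slab n j" "z \<in> open_slab n i" by blast
    then have "W = V" using block_unique cellsD(1)[OF a(2)] cellsD(1)[OF b(2)] by blast
    moreover have "real_of_int i < j + 1" "real_of_int j < i + 1"
      using z by (auto simp: open_slab_def)
    then have "i = j" by linarith
    ultimately show False using \<open>a \<noteq> b\<close> a b by simp
  qed
  then show "disjnt (Y interior_of cell n a) (Y interior_of cell n b)"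
    using V W by (simp add: a b cell_code interior_slab disjnt_def)
next
  fix n b assume "b \<in> idx (Suc n)"
  then obtain W j where b: "b = code (W, j)" "(W, j) \<in> cells (Suc n)" by (auto simp: idx_def)
  obtain z where "z \<in> W" using cellsD(2)[OF b(2)] by blast
  from cell_refine[OF b(2) this] show "\<exists>a\<in>idx n. cell (Suc n) b \<subseteq> cell n a"
    by (auto simp: b(1) idx_def)
next
  show "\<exists>n. \<forall>a\<in>idx n. \<not> (x \<in> cell n a \<and> y \<in> cell n a)"
    if "x \<in> topspace Y" "y \<in> topspace Y" "x \<noteq> y" for x y
    using ex_separating_level that .
next
  fix x n assume x: "x \<in> topspace Y"
  show "address x n \<in> idx n" using floor_cells[OF x] by (simp add: address_def idx_def)
  show "x \<in> cell n (address x n)"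
    unfolding address_def using floor_slab[OF x, of n] block[OF x, of n] by (simp add: cell_code clopen)
  show "cell (Suc n) (address x (Suc n)) \<subseteq> cell n (address x n)"
    using cell_refine(2)[OF floor_cells[OF x] block(2)[OF x], of n]
    by (simp add: address_def floor_level_Suc)
next
  fix x y n assume xy: "(x, y) \<in> ord"
  have T: "x \<in> topspace Y" "y \<in> topspace Y" using xy ord_in by auto
  have "y \<in> block n x" using clopen_ord[OF clopen xy] block T by blast
  then have "block n y = block n x" using block_eq block T by blast
  moreover have "\<lfloor>level n x\<rfloor> \<le> \<lfloor>level n y\<rfloor>"
    using ord_iff[OF T] xy by (intro floor_mono) (simp add: level_le_iff)
  ultimately show "(address x n, address y n) \<in> cell_le Y ord (idx n) (cell n)"
    unfolding address_def using cell_le_iff[OF floor_cells[OF T(1)] floor_cells[OF T(2)], of n]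
    by simp
next
  show "\<exists>a' b'. (a', b') \<in> cell_le Y ord (idx (Suc n)) (cell (Suc n)) \<and>
      cell (Suc n) a' \<subseteq> cell n a \<and> cell (Suc n) b' \<subseteq> cell n b"
    if "(a, b) \<in> cell_le Y ord (idx n) (cell n)" for a b n
    using le_lift that .
qed

text \<open>The blocks give the disjoint summands; within a block the cells are numbered by
  consecutive integers.\<close>

lemma cell_struct_F0: "cell_struct Y ord (idx n) (cell n) \<in> F0"
proof (rule F0_chains[OF finite_cells inj_on_code cells_convex])
  show "lr_R (cell_struct Y ord (idx n) (cell n)) =
    {(code (W, i), code (W, j)) |W i j. (W, i) \<in> cells n \<and> (W, j) \<in> cells n \<and> \<bar>i - j\<bar> \<le> 1}"
    (is "_ = ?R")
  proof (rule equalityI; rule subrelI)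
    fix a b assume "(a, b) \<in> lr_R (cell_struct Y ord (idx n) (cell n))"
    then obtain W i V j where "a = code (W, i)" "(W, i) \<in> cells n" "b = code (V, j)" "(V, j) \<in> cells n"
      "cell n a \<inter> cell n b \<noteq> {}" by (force simp: cell_R_def idx_def)
    then show "(a, b) \<in> ?R" using cell_R_iff by blast
  next
    fix a b assume "(a, b) \<in> ?R"
    then obtain W i j where "a = code (W, i)" "b = code (W, j)" "(W, i) \<in> cells n" "(W, j) \<in> cells n"
      "\<bar>i - j\<bar> \<le> 1" by blast
    then show "(a, b) \<in> lr_R (cell_struct Y ord (idx n) (cell n))"
      using cell_R_iff[of W i n W j] by (auto simp: cell_R_def idx_def)
  qed
  show "lr_le (cell_struct Y ord (idx n) (cell n)) =
    {(code (W, i), code (W, j)) |W i j. (W, i) \<in> cells n \<and> (W, j) \<in> cells n \<and> i \<le> j}"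
    (is "_ = ?R")
  proof (rule equalityI; rule subrelI)
    fix a b assume ab: "(a, b) \<in> lr_le (cell_struct Y ord (idx n) (cell n))"
    then obtain W i V j where "a = code (W, i)" "(W, i) \<in> cells n" "b = code (V, j)" "(V, j) \<in> cells n"
      by (auto simp: cell_le_def idx_def)
    then show "(a, b) \<in> ?R" using cell_le_iff ab by auto
  next
    fix a b assume "(a, b) \<in> ?R"
    then show "(a, b) \<in> lr_le (cell_struct Y ord (idx n) (cell n))"
      using cell_le_iff by auto
  qed
qed (simp_all add: idx_def)

end

theorem theorem4p6:
  fixes Y :: "'a topology" and ord :: "('a \<times> 'a) set"
  assumes "smooth_fence Y" and "strongly_compatible_order Y ord"
  shows "\<exists>(P :: nat \<Rightarrow> nat lr_struct) (\<phi> :: nat \<Rightarrow> nat \<Rightarrow> nat \<Rightarrow> nat).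
    (\<forall>n. P n \<in> F0) \<and>
    fine_projective_sequence P \<phi> \<and>
    (let L = projective_limit P \<phi>;
         Q = R_quotient L;
         p = R_class L;
         int_cell = (\<lambda>n a. Q interior_of (p ` {u \<in> lr_carrier L. u n = a}))
     in irreducible_map (lr_top L) Q p \<and>
        (\<exists>g. homeomorphic_map Q Y g \<and>
          (\<forall>x\<in>topspace Q. \<forall>y\<in>topspace Q. (x, y) \<in> R_quotient_le L \<longleftrightarrow> (g x, g y) \<in> ord) \<and>
          (\<forall>n. \<forall>a\<in>lr_carrier (P n). \<forall>a'\<in>lr_carrier (P n).
            (a, a') \<in> lr_le (P n) \<longleftrightarrow>
            (\<exists>x\<in>int_cell n a. \<exists>x'\<in>int_cell n a'. (g x, g x') \<in> ord))))"
proof -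
  \<comment> \<open>Strong compatibility speaks of common members of
    \<open>connected_components_of\<close>, the locale of the relation
    \<open>connected_component_of\<close>.\<close>
  have component: "(\<exists>C\<in>connected_components_of Y. x \<in> C \<and> y \<in> C) \<longleftrightarrow> connected_component_of Y x y"
    if "x \<in> topspace Y" for x y
  proof
    assume "\<exists>C\<in>connected_components_of Y. x \<in> C \<and> y \<in> C"
    then show "connected_component_of Y x y"
      using connectedin_connected_components_of by (auto simp: connected_component_of_def)
  next
    assume "connected_component_of Y x y"
    then show "\<exists>C\<in>connected_components_of Y. x \<in> C \<and> y \<in> C"
      using that by (intro bexI[of _ "connected_component_of_set Y x"])
        (auto simp: connected_component_of_refl connected_component_in_connected_components_of)
  qed
  interpret fence_space Y ord
    using assms component
    by unfold_locales (auto simp: smooth_fence_def fence_def strongly_compatible_order_def)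
  obtain h where "continuous_map Y euclideanreal h" "strictly_isotone h"
    "\<And>W t t'. \<lbrakk>clopenin Y W; t \<in> \<rat>; t' \<in> \<rat>; t \<le> t'; touched h W t t'\<rbrakk> \<Longrightarrow> crossed h W t t'"
    using ex_generic_height by blast
  then interpret height_space Y ord h
    by unfold_locales
  obtain \<W> where "\<And>n. partition n (\<W> n)"
    "\<And>n W. W \<in> \<W> (Suc n) \<Longrightarrow> \<exists>V\<in>\<W> n. W \<subseteq> V"
    "\<And>E. clopenin Y E \<Longrightarrow> \<exists>n. \<forall>W\<in>\<W> n. W \<subseteq> E \<or> disjnt W E"
    using ex_partitions by blast
  then interpret partitioned_fence Y ord h \<W>
    by unfold_locales
  show ?thesis
    using cell_struct_F0 limit_representation
    by (intro exI[of _ "\<lambda>n. cell_struct Y ord (idx n) (cell n)"] exI[of _ bond] conjI) simp_all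
qed

end
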